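(* The elements $$X^l_{mn}=\frac{1}{2\pi i}\oint (x_{11}s+x_{21})^{l-m}(x_{12}s+x_{22})^{l+m}s^{\,n-l-1}\,ds,\qquad l\in\tfrac12\mathbb{Z}_{\geq 0},\ -l\leq n,m\leq l,\ n,m\equiv l \pmod 1,$$ of $\mathfrak{M}^{\rm I}$, where the integration variable $s$ commutes with the generators $x_{kl}$, form a basis of the space of solutions $f\in\mathfrak{M}^{\rm I}$ of the quantum Laplace equation $\square_x f=0$.
   Context: $q$ is a formal parameter; all algebras are over $\mathbb{C}(q)$, and $p\in\{q,q^{-1}\}$ is fixed. $\mathfrak{M}^{\rm I}$ is the algebra generated by $x_{11},x_{12},x_{21},x_{22}$ with relations $$x_{11}x_{12}=x_{12}x_{11},\quad x_{21}x_{22}=x_{22}x_{21},\quad [x_{11},x_{22}]+[x_{21},x_{12}]=0,$$ $$x_{11}x_{21}=q^{-2}x_{21}x_{11},\quad x_{12}x_{22}=q^{-2}x_{22}x_{12},\quad x_{21}x_{12}=q^{2}x_{12}x_{21}.$$ The contour integral is around $s=0$, i.e. $\frac{1}{2\pi i}\oint(\cdot)\,ds$ extracts the coefficient of $s^{-1}$. Differential calculus: let $R_{11,11}=R_{22,22}=p^{-1}$, $R_{12,12}=q$, $R_{21,21}=q^{-1}$, $R_{12,21}=p^{-1}-q^{-1}$, $R_{21,12}=p^{-1}-q$, and all other $R_{ij,mn}=0$ ($i,j,m,n\in\{1,2\}$). The module of 1-forms $\Omega^1$ is the $\mathfrak{M}^{\rm I}$-bimodule generated by $dx_{11},dx_{12},dx_{21},dx_{22}$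 with relations $$dx_{jl}\,x_{ik}=\sum_{m,n,a,b\in\{1,2\}}R_{ij,mn}\,R_{ba,lk}\;x_{ma}\,dx_{nb};$$ it is free as a left module on the $dx_{rs}$. The de Rham operator $d:\mathfrak{M}^{\rm I}\to\Omega^1$ is the linear map with $x_{rs}\mapsto dx_{rs}$ and $d(fg)=(df)g+f\,dg$. The quantum partial derivatives are defined by $$df=(\partial_{11}f)\,dx_{11}+(\partial_{12}f)\,dx_{12}+(\partial_{21}f)\,dx_{21}+(\partial_{22}f)\,dx_{22},$$ and the quantum Laplacian is $\square_x=\partial_{11}\partial_{22}-\partial_{21}\partial_{12}$. *)

theory Defs
  imports
    "HOL-Analysis.Finite_Cartesian_Product"
    "HOL-Library.Poly_Mapping"
    "HOL-Computational_Algebra.Fraction_Field"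
    "HOL-Computational_Algebra.Formal_Laurent_Series"
begin

unbundle no fps_syntax

section \<open>The ground field\<close>

type_synonym cq = "complex poly fract"

definition qpar :: cq where
  "qpar = Fract [:0, 1:] 1"

lemma qpar_nonzero [simp]: "qpar \<noteq> 0"
  by (simp add: qpar_def Zero_fract_def eq_fract)


section \<open>The free algebra on four generators\<close>

datatype ix = One | Two

lemma UNIV_ix: "(UNIV :: ix set) = {One, Two}"
  using ix.exhaust by auto

instance ix :: finite
  by standard (simp add: UNIV_ix)

text \<open>The pair \<open>(r, s)\<close> stands for the generator \<open>x\<^sub>r\<^sub>s\<close>.\<close>

type_synonym gen = "ix \<times> ix"

datatype word = Word "gen list"

instantiation word :: monoid_add
begin

definition zero_word :: word where
  "0 = Word []"

fun plus_word :: "word \<Rightarrow> word \<Rightarrow> word" where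
  "Word u + Word v = Word (u @ v)"

instance
proof
  fix a b c :: word
  show "a + b + c = a + (b + c)" by (cases a; cases b; cases c) simp
  show "0 + a = a" by (cases a) (simp add: zero_word_def)
  show "a + 0 = a" by (cases a) (simp add: zero_word_def)
qed

end

text \<open>The monoid algebra of the word monoid; its product is the convolution product of
  \<^theory>\<open>HOL-Library.Poly_Mapping\<close>.\<close>

type_synonym free = "word \<Rightarrow>\<^sub>0 cq"

definition X_free :: "ix \<Rightarrow> ix \<Rightarrow> free" where
  "X_free r s = Poly_Mapping.single (Word [(r, s)]) 1"

definition const_free :: "cq \<Rightarrow> free" where
  "const_free c = Poly_Mapping.single 0 c"

lemma free_induct:
  assumes "\<And>w c. P (Poly_Mapping.single w c)" "\<And>f g. P f \<Longrightarrow> P g \<Longrightarrow> P (f + g)"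
  shows "P (f :: free)"
proof (induction f rule: update_induct)
  case (const)
  show ?case using assms(1)[of 0 0] by simp
next
  case (update f a b)
  have "Poly_Mapping.update a b f = Poly_Mapping.single a b + f"
    using update by (intro poly_mapping_eqI) 
      (auto simp: lookup_update lookup_add lookup_single when_def in_keys_iff)
  then show ?case using assms update by simp
qed

lemma const_free_mult_single:
  "const_free c * Poly_Mapping.single w d = Poly_Mapping.single w (c * d)"
  by (simp add: const_free_def mult_single)

lemma const_free_central: "const_free c * f = f * const_free c"
  by (induction f rule: free_induct)
     (simp_all add: const_free_def mult_single algebra_simps mult.commute)


section \<open>The algebra of quantum matrices\<close>

definition relators :: "free set" where
  "relators =
    (let x11 = X_free One One; x12 = X_free One Two; x21 = X_free Two One; x22 = X_free Two Two in
     {x11 * x12 - x12 * x11,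
      x21 * x22 - x22 * x21,
      (x11 * x22 - x22 * x11) + (x21 * x12 - x12 * x21),
      x11 * x21 - const_free (inverse (qpar^2)) * (x21 * x11),
      x12 * x22 - const_free (inverse (qpar^2)) * (x22 * x12),
      x21 * x12 - const_free (qpar^2) * (x12 * x21)})"

inductive_set rel_ideal :: "free set" where
  zero: "0 \<in> rel_ideal"
| relator: "r \<in> relators \<Longrightarrow> r \<in> rel_ideal"
| add: "f \<in> rel_ideal \<Longrightarrow> g \<in> rel_ideal \<Longrightarrow> f + g \<in> rel_ideal"
| mult_left: "f \<in> rel_ideal \<Longrightarrow> h * f \<in> rel_ideal"
| mult_right: "f \<in> rel_ideal \<Longrightarrow> f * h \<in> rel_ideal"

lemma rel_ideal_uminus: "f \<in> rel_ideal \<Longrightarrow> - f \<in> rel_ideal"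
  using rel_ideal.mult_left[of f "- 1"] by simp

lemma rel_ideal_diff: "f \<in> rel_ideal \<Longrightarrow> g \<in> rel_ideal \<Longrightarrow> f - g \<in> rel_ideal"
  using rel_ideal.add[OF _ rel_ideal_uminus, of f g] by simp

lemma lookup_mult_zero: "Poly_Mapping.lookup (f * g) 0 = Poly_Mapping.lookup f 0 * Poly_Mapping.lookup (g :: free) 0"
proof (induction f rule: free_induct)
  case (1 u c)
  show ?case
  proof (induction g rule: free_induct)
    case (1 v d)
    have "u + v = 0 \<longleftrightarrow> u = 0 \<and> v = 0"
      by (cases u; cases v) (auto simp: zero_word_def)
    then show ?case by (auto simp: mult_single lookup_single when_def)
  qed (simp add: lookup_add algebra_simps)
qed (simp add: lookup_add algebra_simps)

lemma rel_ideal_lookup_zero: "f \<in> rel_ideal \<Longrightarrow> Poly_Mapping.lookup f 0 = 0"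
proof (induction rule: rel_ideal.induct)
  case (relator r)
  have "Poly_Mapping.lookup (X_free i j) 0 = 0" for i j
    by (simp add: X_free_def lookup_single zero_word_def)
  then show ?case using relator
    by (auto simp: relators_def Let_def lookup_minus lookup_add lookup_mult_zero)
qed (simp_all add: lookup_add lookup_mult_zero)

quotient_type qmat = free / "\<lambda>f g. f - g \<in> rel_ideal"
proof (rule equivpI)
  show "reflp (\<lambda>f g. f - g \<in> rel_ideal)"
    by (rule reflpI) (simp add: rel_ideal.zero)
  show "symp (\<lambda>f g. f - g \<in> rel_ideal)"
    by (rule sympI) (metis minus_diff_eq rel_ideal_uminus)
  show "transp (\<lambda>f g. f - g \<in> rel_ideal)"
  proof (rule transpI)
    fix f g h :: free
    assume "f - g \<in> rel_ideal" "g - h \<in> rel_ideal"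
    then have "(f - g) + (g - h) \<in> rel_ideal" by (rule rel_ideal.add)
    then show "f - h \<in> rel_ideal" by simp
  qed
qed

instantiation qmat :: ring_1
begin

lift_definition zero_qmat :: qmat is 0 .
lift_definition one_qmat :: qmat is 1 .
lift_definition plus_qmat :: "qmat \<Rightarrow> qmat \<Rightarrow> qmat" is "(+)"
  by (metis add_diff_add rel_ideal.add)
lift_definition uminus_qmat :: "qmat \<Rightarrow> qmat" is uminus
  by (metis minus_diff_minus rel_ideal_uminus)
lift_definition minus_qmat :: "qmat \<Rightarrow> qmat \<Rightarrow> qmat" is "(-)"
proof -
  fix a b c d :: free
  assume "a - b \<in> rel_ideal" "c - d \<in> rel_ideal"
  then have "(a - b) - (c - d) \<in> rel_ideal" by (rule rel_ideal_diff)
  then show "(a - c) - (b - d) \<in> rel_ideal" by (simp add: algebra_simps)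
qed
lift_definition times_qmat :: "qmat \<Rightarrow> qmat \<Rightarrow> qmat" is "(*)"
proof -
  fix a b c d :: free
  assume "a - b \<in> rel_ideal" "c - d \<in> rel_ideal"
  then have "(a - b) * c + b * (c - d) \<in> rel_ideal"
    by (intro rel_ideal.add rel_ideal.mult_left rel_ideal.mult_right)
  then show "a * c - b * d \<in> rel_ideal" by (simp add: algebra_simps)
qed

instance
proof
  fix a b c :: qmat
  show "a + b + c = a + (b + c)" by transfer (simp add: algebra_simps rel_ideal.zero)
  show "a + b = b + a" by transfer (simp add: algebra_simps rel_ideal.zero)
  show "0 + a = a" by transfer (simp add: rel_ideal.zero)
  show "- a + a = 0" by transfer (simp add: rel_ideal.zero)
  show "a - b = a + - b" by transfer (simp add: rel_ideal.zero)
  show "a * b * c = a * (b * c)" by transfer (simp add: algebra_simps rel_ideal.zero)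
  show "1 * a = a" by transfer (simp add: rel_ideal.zero)
  show "a * 1 = a" by transfer (simp add: rel_ideal.zero)
  show "(a + b) * c = a * c + b * c" by transfer (simp add: algebra_simps rel_ideal.zero)
  show "a * (b + c) = a * b + a * c" by transfer (simp add: algebra_simps rel_ideal.zero)
  show "(0::qmat) \<noteq> 1"
    by transfer (metis diff_0 lookup_one_zero lookup_uminus neg_equal_0_iff_equal
        rel_ideal_lookup_zero zero_neq_one)
qed

end

lift_definition xgen :: "ix \<Rightarrow> ix \<Rightarrow> qmat" is X_free .

lift_definition scalar :: "cq \<Rightarrow> qmat" is const_free .

abbreviation qscale :: "cq \<Rightarrow> qmat \<Rightarrow> qmat" where
  "qscale c f \<equiv> scalar c * f"

lemma scalar_0 [simp]: "scalar 0 = 0"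
  by transfer (simp add: const_free_def rel_ideal.zero)

lemma scalar_1 [simp]: "scalar 1 = 1"
  by transfer (simp add: const_free_def rel_ideal.zero)

lemma scalar_add: "scalar (c + d) = scalar c + scalar d"
  by transfer (simp add: const_free_def single_add rel_ideal.zero)

lemma scalar_mult: "scalar (c * d) = scalar c * scalar d"
  by transfer (simp add: const_free_def mult_single rel_ideal.zero)

lemma scalar_uminus: "scalar (- c) = - scalar c"
  by transfer (simp add: const_free_def single_uminus rel_ideal.zero)

lemma scalar_diff: "scalar (c - d) = scalar c - scalar d"
  by transfer (simp add: const_free_def single_diff rel_ideal.zero)

lemma scalar_central: "f * scalar c = scalar c * f"
  by transfer (simp add: const_free_central rel_ideal.zero)

interpretation qmat: vector_space qscale
  by standard (simp_all add: algebra_simps scalar_add scalar_mult)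

lemma x_relations:
  "xgen One One * xgen One Two = xgen One Two * xgen One One"
  "xgen Two One * xgen Two Two = xgen Two Two * xgen Two One"
  "(xgen One One * xgen Two Two - xgen Two Two * xgen One One)
    + (xgen Two One * xgen One Two - xgen One Two * xgen Two One) = 0"
  "xgen One One * xgen Two One = qscale (inverse (qpar^2)) (xgen Two One * xgen One One)"
  "xgen One Two * xgen Two Two = qscale (inverse (qpar^2)) (xgen Two Two * xgen One Two)"
  "xgen Two One * xgen One Two = qscale (qpar^2) (xgen One Two * xgen Two One)"
  by (transfer; rule rel_ideal.relator; simp add: relators_def Let_def)+

lemma qmat_induct [case_names scalar x add mult]:
  assumes "\<And>c. P (scalar c)" "\<And>r s. P (xgen r s)"
    "\<And>f g. P f \<Longrightarrow> P g \<Longrightarrow> P (f + g)" "\<And>f g. P f \<Longrightarrow> P g \<Longrightarrow> P (f * g)"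
  shows "P f"
proof -
  have word: "P (abs_qmat (Poly_Mapping.single (Word w) c))" for w c
  proof (induction w rule: rev_induct)
    case Nil
    show ?case using assms(1)[of c]
      by (simp add: scalar.abs_eq const_free_def zero_word_def)
  next
    case (snoc g w)
    obtain r s where g: "g = (r, s)" by (cases g)
    have "abs_qmat (Poly_Mapping.single (Word (w @ [g])) c)
        = abs_qmat (Poly_Mapping.single (Word w) c) * xgen r s"
      by (simp add: xgen.abs_eq X_free_def times_qmat.abs_eq mult_single g)
    then show ?case using snoc assms(2,4) by simp
  qed
  have "P (abs_qmat g)" for g
  proof (induction g rule: free_induct)
    case (1 w c)
    then show ?case using word by (cases w) simp
  next
    case (2 f g)
    then show ?case using assms(3) by (metis plus_qmat.abs_eq)
  qed
  from this[of "rep_qmat f"] show ?thesis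
    by (simp only: Quotient3_abs_rep[OF Quotient3_qmat])
qed


section \<open>The differential calculus\<close>

fun Rmat :: "cq \<Rightarrow> ix \<times> ix \<Rightarrow> ix \<times> ix \<Rightarrow> cq" where
  "Rmat p (One, One) (One, One) = inverse p"
| "Rmat p (Two, Two) (Two, Two) = inverse p"
| "Rmat p (One, Two) (One, Two) = qpar"
| "Rmat p (Two, One) (Two, One) = inverse qpar"
| "Rmat p (One, Two) (Two, One) = inverse p - inverse qpar"
| "Rmat p (Two, One) (One, Two) = inverse p - qpar"
| "Rmat p _ _ = 0"

text \<open>One-forms are represented by their coordinates in the left basis \<open>dx\<^sub>r\<^sub>s\<close>; the left
  module structure is \<^term>\<open>(*s)\<close>.  The right module structure is the one forced by the
  commutation relations; it exists and is unique (\<open>right_action_ex1\<close> below), and the resulting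
  bimodule has the universal property of the one presented by these relations
  (\<open>form_universal\<close> below).\<close>

type_synonym form = "(qmat, gen) vec"

definition dx :: "ix \<Rightarrow> ix \<Rightarrow> form" where
  "dx r s = axis (r, s) 1"

definition right_action :: "cq \<Rightarrow> (form \<Rightarrow> qmat \<Rightarrow> form) \<Rightarrow> bool" where
  "right_action p act \<longleftrightarrow>
    (\<forall>\<omega> \<eta> f. act (\<omega> + \<eta>) f = act \<omega> f + act \<eta> f) \<and>
    (\<forall>\<omega> f g. act \<omega> (f + g) = act \<omega> f + act \<omega> g) \<and>
    (\<forall>\<omega> f g. act \<omega> (f * g) = act (act \<omega> f) g) \<and>
    (\<forall>\<omega> c. act \<omega> (scalar c) = scalar c *s \<omega>) \<and>
    (\<forall>\<omega> f g. act (f *s \<omega>) g = f *s act \<omega> g) \<and>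
    (\<forall>i j k l. act (dx j l) (xgen i k) =
      (\<Sum>m\<in>UNIV. \<Sum>n\<in>UNIV. \<Sum>a\<in>UNIV. \<Sum>b\<in>UNIV.
        qscale (Rmat p (i, j) (m, n) * Rmat p (b, a) (l, k)) (xgen m a) *s dx n b))"

definition rmult :: "cq \<Rightarrow> form \<Rightarrow> qmat \<Rightarrow> form" where
  "rmult p = (THE act. right_action p act)"

definition de_Rham :: "cq \<Rightarrow> (qmat \<Rightarrow> form) \<Rightarrow> bool" where
  "de_Rham p D \<longleftrightarrow>
    (\<forall>f g. D (f + g) = D f + D g) \<and>
    (\<forall>c f. D (qscale c f) = scalar c *s D f) \<and>
    (\<forall>r s. D (xgen r s) = dx r s) \<and>
    (\<forall>f g. D (f * g) = rmult p (D f) g + f *s D g)"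

definition ext_d :: "cq \<Rightarrow> qmat \<Rightarrow> form" where
  "ext_d p = (THE D. de_Rham p D)"

definition partial :: "cq \<Rightarrow> ix \<Rightarrow> ix \<Rightarrow> qmat \<Rightarrow> qmat" where
  "partial p r s f = ext_d p f $ (r, s)"

lemma ext_d_eq_partial:
  "ext_d p f = (\<Sum>r\<in>UNIV. \<Sum>s\<in>UNIV. partial p r s f *s dx r s)"
  unfolding partial_def dx_def sum.cartesian_product UNIV_Times_UNIV
  by (subst basis_expansion[symmetric]) (simp add: case_prod_beta)

definition laplacian :: "cq \<Rightarrow> qmat \<Rightarrow> qmat" where
  "laplacian p f =
    partial p One One (partial p Two Two f) - partial p Two One (partial p One Two f)"


section \<open>The elements \<open>X\<^sup>l\<^sub>m\<^sub>n\<close>\<close>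

text \<open>Coefficients of a formal Laurent series commute with its variable, which plays the role of
  the integration variable \<open>s\<close>; the contour integral is the formal residue.\<close>

definition Xelem :: "rat \<Rightarrow> rat \<Rightarrow> rat \<Rightarrow> qmat" where
  "Xelem l m n = fls_residue
     ((fls_const (xgen One One) * fls_X + fls_const (xgen Two One)) ^ nat \<lfloor>l - m\<rfloor> *
      (fls_const (xgen One Two) * fls_X + fls_const (xgen Two Two)) ^ nat \<lfloor>l + m\<rfloor> *
      fls_X_intpow \<lfloor>n - l - 1\<rfloor>)"

definition Xindex :: "(rat \<times> rat \<times> rat) set" where
  "Xindex = {(l, m, n). (\<exists>k::nat. l = of_nat k / 2) \<and> - l \<le> n \<and> n \<le> l \<and> - l \<le> m \<and> m \<le> l \<and>
     n - l \<in> \<int> \<and> m - l \<in> \<int>}"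


section \<open>Existence and uniqueness\<close>

subsection \<open>Right action of the free algebra\<close>

definition cross :: "cq \<Rightarrow> gen \<Rightarrow> gen \<Rightarrow> form" where
  "cross p = (\<lambda>(j, l) (i, k).
      (\<Sum>m\<in>UNIV. \<Sum>n\<in>UNIV. \<Sum>a\<in>UNIV. \<Sum>b\<in>UNIV.
        qscale (Rmat p (i, j) (m, n) * Rmat p (b, a) (l, k)) (xgen m a) *s dx n b))"

definition gen_act :: "cq \<Rightarrow> gen \<Rightarrow> form \<Rightarrow> form" where
  "gen_act p g \<omega> = (\<Sum>h\<in>UNIV. (\<omega> $ h) *s cross p h g)"

fun word_act :: "cq \<Rightarrow> form \<Rightarrow> word \<Rightarrow> form" where
  "word_act p \<omega> (Word w) = fold (gen_act p) w \<omega>"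

definition lin_ext :: "(word \<Rightarrow> form) \<Rightarrow> free \<Rightarrow> form" where
  "lin_ext \<phi> f = (\<Sum>w\<in>Poly_Mapping.keys f. scalar (Poly_Mapping.lookup f w) *s \<phi> w)"

lemma lin_ext_superset:
  assumes "finite A" "Poly_Mapping.keys f \<subseteq> A"
  shows "lin_ext \<phi> f = (\<Sum>w\<in>A. scalar (Poly_Mapping.lookup f w) *s \<phi> w)"
  unfolding lin_ext_def using assms
  by (intro sum.mono_neutral_left) (auto simp: in_keys_iff)

lemma lin_ext_add: "lin_ext \<phi> (f + g) = lin_ext \<phi> f + lin_ext \<phi> g"
proof -
  let ?A = "Poly_Mapping.keys f \<union> Poly_Mapping.keys g"
  show ?thesis
    using keys_add[of f g]
    by (simp add: lin_ext_superset[of ?A] lookup_add scalar_add vector_sadd_rdistrib sum.distrib)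
qed

lemma lin_ext_single: "lin_ext \<phi> (Poly_Mapping.single w c) = scalar c *s \<phi> w"
  by (subst lin_ext_superset[of "{w}"]) auto

definition free_act :: "cq \<Rightarrow> form \<Rightarrow> free \<Rightarrow> form" where
  "free_act p \<omega> = lin_ext (word_act p \<omega>)"

lemma gen_act_add: "gen_act p g (\<omega> + \<eta>) = gen_act p g \<omega> + gen_act p g \<eta>"
  by (simp add: gen_act_def vector_sadd_rdistrib sum.distrib)

lemma sum_vector_smult:
  "(c :: 'a::ring_1) *s (\<Sum>i\<in>A. \<phi> i) = (\<Sum>i\<in>A. c *s (\<phi> i :: ('a, 'n::finite) vec))"
  by (induction A rule: infinite_finite_induct) (simp_all add: vector_add_ldistrib)

lemma gen_act_smult: "gen_act p g (f *s \<omega>) = f *s gen_act p g \<omega>"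
  by (simp add: gen_act_def sum_vector_smult vector_smult_assoc)

lemma fold_gen_act_add:
  "fold (gen_act p) w (\<omega> + \<eta>) = fold (gen_act p) w \<omega> + fold (gen_act p) w \<eta>"
  by (induction w arbitrary: \<omega> \<eta>) (simp_all add: gen_act_add)

lemma fold_gen_act_smult: "fold (gen_act p) w (f *s \<omega>) = f *s fold (gen_act p) w \<omega>"
  by (induction w arbitrary: \<omega>) (simp_all add: gen_act_smult)

lemma free_act_single: "free_act p \<omega> (Poly_Mapping.single w c) = scalar c *s word_act p \<omega> w"
  by (simp add: free_act_def lin_ext_single)

lemma free_act_add_right: "free_act p \<omega> (f + g) = free_act p \<omega> f + free_act p \<omega> g"
  by (simp add: free_act_def lin_ext_add)

lemma free_act_add_left: "free_act p (\<omega> + \<eta>) f = free_act p \<omega> f + free_act p \<eta> f"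
proof (induction f rule: free_induct)
  case (1 w c)
  show ?case by (cases w) (simp add: free_act_single fold_gen_act_add vector_add_ldistrib)
qed (simp add: free_act_add_right)

lemma free_act_smult: "free_act p (f *s \<omega>) g = f *s free_act p \<omega> g"
proof (induction g rule: free_induct)
  case (1 w c)
  show ?case
    by (cases w) (simp add: free_act_single fold_gen_act_smult vector_smult_assoc scalar_central[of f])
qed (simp add: free_act_add_right vector_add_ldistrib)

lemma free_act_mult: "free_act p \<omega> (f * g) = free_act p (free_act p \<omega> f) g"
proof (induction f rule: free_induct)
  case (1 u c)
  show ?case
  proof (induction g rule: free_induct)
    case (1 v e)
    have "scalar (c * e) = scalar e * scalar c"
      by (simp add: scalar_mult scalar_central[of "scalar c"])
    then show ?case
      by (cases u; cases v)
         (simp add: mult_single free_act_single fold_gen_act_smult vector_smult_assoc)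
  qed (simp add: algebra_simps free_act_add_right)
qed (simp add: algebra_simps free_act_add_right free_act_add_left)

lemma free_act_uminus: "free_act p \<omega> (- f) = - free_act p \<omega> f"
  using free_act_add_right[of p \<omega> f "- f"] free_act_add_right[of p \<omega> 0 0]
  by (simp add: eq_neg_iff_add_eq_0 add.commute)

lemma free_act_diff: "free_act p \<omega> (f - g) = free_act p \<omega> f - free_act p \<omega> g"
  using free_act_add_right[of p \<omega> f "- g"] by (simp add: free_act_uminus)

lemma free_act_zero_left: "free_act p 0 f = 0"
  using free_act_smult[of p 0 0 f] by simp

lemma free_act_zero_right: "free_act p \<omega> 0 = 0"
  using free_act_diff[of p \<omega> 0 0] by simp

lemma free_act_X: "free_act p \<omega> (X_free r s) = gen_act p (r, s) \<omega>"
  by (simp add: X_free_def free_act_single)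

lemma free_act_const: "free_act p \<omega> (const_free c) = scalar c *s \<omega>"
  by (simp add: const_free_def free_act_single zero_word_def)

lemma gen_act_dx: "gen_act p g (dx r s) = cross p (r, s) g"
proof -
  have "gen_act p g (dx r s) = (\<Sum>h\<in>UNIV. if h = (r, s) then cross p h g else 0)"
    unfolding gen_act_def dx_def by (intro sum.cong) (auto simp: axis_def)
  then show ?thesis by simp
qed


subsection \<open>Compatibility with the relations\<close>

lemma scalar_qpar_inverse:
  "scalar qpar * scalar (inverse qpar) = 1" "scalar (inverse qpar) * scalar qpar = 1"
  "scalar qpar * (scalar (inverse qpar) * f) = f" "scalar (inverse qpar) * (scalar qpar * f) = f"
  by (simp_all flip: scalar_mult mult.assoc)

lemma scalar_power2:
  "scalar (qpar^2) = scalar qpar * scalar qpar"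
  "scalar (inverse (qpar^2)) = scalar (inverse qpar) * scalar (inverse qpar)"
  by (simp_all only: power2_eq_square inverse_mult_distrib scalar_mult)

lemma scalar_move:
  "xgen r s * scalar c = scalar c * xgen r s"
  "xgen r s * (scalar c * f) = scalar c * (xgen r s * f)"
  by (metis mult.assoc scalar_central)+

lemma xgen_normal:
  "xgen One Two * xgen One One = xgen One One * xgen One Two"
  "xgen Two Two * xgen Two One = xgen Two One * xgen Two Two"
  "xgen Two One * xgen One One = scalar qpar * (scalar qpar * (xgen One One * xgen Two One))"
  "xgen Two Two * xgen One Two = scalar qpar * (scalar qpar * (xgen One Two * xgen Two Two))"
  "xgen Two One * xgen One Two = scalar qpar * (scalar qpar * (xgen One Two * xgen Two One))"
  "xgen Two Two * xgen One One = xgen One One * xgen Two Two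
     + scalar qpar * (scalar qpar * (xgen One Two * xgen Two One)) - xgen One Two * xgen Two One"
proof -
  show "xgen One Two * xgen One One = xgen One One * xgen One Two"
    by (rule x_relations(1)[symmetric])
  show "xgen Two Two * xgen Two One = xgen Two One * xgen Two Two"
    by (rule x_relations(2)[symmetric])
  show "xgen Two One * xgen One One = scalar qpar * (scalar qpar * (xgen One One * xgen Two One))"
    by (simp only: x_relations(4) scalar_power2 mult.assoc scalar_qpar_inverse)
  show "xgen Two Two * xgen One Two = scalar qpar * (scalar qpar * (xgen One Two * xgen Two Two))"
    by (simp only: x_relations(5) scalar_power2 mult.assoc scalar_qpar_inverse)
  show eq5: "xgen Two One * xgen One Two = scalar qpar * (scalar qpar * (xgen One Two * xgen Two One))"
    by (simp only: x_relations(6) scalar_power2 mult.assoc)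
  show "xgen Two Two * xgen One One = xgen One One * xgen Two Two
     + scalar qpar * (scalar qpar * (xgen One Two * xgen Two One)) - xgen One Two * xgen Two One"
    using x_relations(3) unfolding eq5 by (simp add: algebra_simps)
qed

lemma gen_act_zero: "gen_act p g 0 = 0"
  using gen_act_smult[of p g 0 0] by simp

lemma scalar_left_commute: "f * (scalar c * g) = scalar c * (f * g)"
  by (metis mult.assoc scalar_central)

lemma dx_nth: "dx r s $ (n, b) = (if n = r \<and> b = s then 1 else 0)"
  by (simp add: dx_def axis_def)

lemma sum_ix: "sum f (UNIV :: ix set) = f One + f Two"
  by (simp add: UNIV_ix)

lemma gen_act_nth: "gen_act p (i, k) \<omega> $ (n, b) =
  (\<Sum>j\<in>UNIV. \<Sum>l\<in>UNIV. \<Sum>m\<in>UNIV. \<Sum>a\<in>UNIV.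
     qscale (Rmat p (i, j) (m, n) * Rmat p (b, a) (l, k)) (\<omega> $ (j, l) * xgen m a))"
proof -
  have *: "(UNIV :: gen set) = UNIV \<times> UNIV" by simp
  have **: "cross p (j, l) (i, k) $ (n, b) =
    (\<Sum>m\<in>UNIV. \<Sum>a\<in>UNIV. qscale (Rmat p (i, j) (m, n) * Rmat p (b, a) (l, k)) (xgen m a))" for j l
    unfolding cross_def by (cases n; cases b; simp add: sum_ix dx_nth del: Rmat.simps)
  have "gen_act p (i, k) \<omega> $ (n, b) = (\<Sum>j\<in>UNIV. \<Sum>l\<in>UNIV. \<omega> $ (j, l) * cross p (j, l) (i, k) $ (n, b))"
    unfolding gen_act_def * by (simp add: sum.cartesian_product case_prod_beta)
  also have "\<dots> = (\<Sum>j\<in>UNIV. \<Sum>l\<in>UNIV. \<Sum>m\<in>UNIV. \<Sum>a\<in>UNIV.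
     qscale (Rmat p (i, j) (m, n) * Rmat p (b, a) (l, k)) (\<omega> $ (j, l) * xgen m a))"
    by (simp only: ** sum_distrib_left scalar_left_commute)
  finally show ?thesis .
qed

lemma form_eq_iff: "\<omega> = \<eta> \<longleftrightarrow> (\<forall>n b. \<omega> $ (n, b) = \<eta> $ (n, b))"
  for \<omega> \<eta> :: form
  by (metis (no_types, lifting) surj_pair vec_eq_iff)

lemma all_ix: "(\<forall>n::ix. P n) \<longleftrightarrow> P One \<and> P Two"
  by (metis ix.exhaust)


lemmas gen_act_q =
  gen_act_nth[of "qpar" One One _ One One, unfolded sum_ix Rmat.simps, simplified scalar_mult scalar_diff mult.assoc scalar_qpar_inverse, simplified scalar_mult mult.assoc]
  gen_act_nth[of "qpar" One One _ One Two, unfolded sum_ix Rmat.simps, simplified scalar_mult scalar_diff mult.assoc scalar_qpar_inverse, simplified scalar_mult mult.assoc]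
  gen_act_nth[of "qpar" One One _ Two One, unfolded sum_ix Rmat.simps, simplified scalar_mult scalar_diff mult.assoc scalar_qpar_inverse, simplified scalar_mult mult.assoc]
  gen_act_nth[of "qpar" One One _ Two Two, unfolded sum_ix Rmat.simps, simplified scalar_mult scalar_diff mult.assoc scalar_qpar_inverse, simplified scalar_mult mult.assoc]
  gen_act_nth[of "qpar" One Two _ One One, unfolded sum_ix Rmat.simps, simplified scalar_mult scalar_diff mult.assoc scalar_qpar_inverse, simplified scalar_mult mult.assoc]
  gen_act_nth[of "qpar" One Two _ One Two, unfolded sum_ix Rmat.simps, simplified scalar_mult scalar_diff mult.assoc scalar_qpar_inverse, simplified scalar_mult mult.assoc]
  gen_act_nth[of "qpar" One Two _ Two One, unfolded sum_ix Rmat.simps, simplified scalar_mult scalar_diff mult.assoc scalar_qpar_inverse, simplified scalar_mult mult.assoc]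
  gen_act_nth[of "qpar" One Two _ Two Two, unfolded sum_ix Rmat.simps, simplified scalar_mult scalar_diff mult.assoc scalar_qpar_inverse, simplified scalar_mult mult.assoc]
  gen_act_nth[of "qpar" Two One _ One One, unfolded sum_ix Rmat.simps, simplified scalar_mult scalar_diff mult.assoc scalar_qpar_inverse, simplified scalar_mult mult.assoc]
  gen_act_nth[of "qpar" Two One _ One Two, unfolded sum_ix Rmat.simps, simplified scalar_mult scalar_diff mult.assoc scalar_qpar_inverse, simplified scalar_mult mult.assoc]
  gen_act_nth[of "qpar" Two One _ Two One, unfolded sum_ix Rmat.simps, simplified scalar_mult scalar_diff mult.assoc scalar_qpar_inverse, simplified scalar_mult mult.assoc]
  gen_act_nth[of "qpar" Two One _ Two Two, unfolded sum_ix Rmat.simps, simplified scalar_mult scalar_diff mult.assoc scalar_qpar_inverse, simplified scalar_mult mult.assoc]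
  gen_act_nth[of "qpar" Two Two _ One One, unfolded sum_ix Rmat.simps, simplified scalar_mult scalar_diff mult.assoc scalar_qpar_inverse, simplified scalar_mult mult.assoc]
  gen_act_nth[of "qpar" Two Two _ One Two, unfolded sum_ix Rmat.simps, simplified scalar_mult scalar_diff mult.assoc scalar_qpar_inverse, simplified scalar_mult mult.assoc]
  gen_act_nth[of "qpar" Two Two _ Two One, unfolded sum_ix Rmat.simps, simplified scalar_mult scalar_diff mult.assoc scalar_qpar_inverse, simplified scalar_mult mult.assoc]
  gen_act_nth[of "qpar" Two Two _ Two Two, unfolded sum_ix Rmat.simps, simplified scalar_mult scalar_diff mult.assoc scalar_qpar_inverse, simplified scalar_mult mult.assoc]
lemmas gen_act_iq =
  gen_act_nth[of "inverse qpar" One One _ One One, unfolded sum_ix Rmat.simps, simplified scalar_mult scalar_diff mult.assoc scalar_qpar_inverse, simplified scalar_mult mult.assoc]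
  gen_act_nth[of "inverse qpar" One One _ One Two, unfolded sum_ix Rmat.simps, simplified scalar_mult scalar_diff mult.assoc scalar_qpar_inverse, simplified scalar_mult mult.assoc]
  gen_act_nth[of "inverse qpar" One One _ Two One, unfolded sum_ix Rmat.simps, simplified scalar_mult scalar_diff mult.assoc scalar_qpar_inverse, simplified scalar_mult mult.assoc]
  gen_act_nth[of "inverse qpar" One One _ Two Two, unfolded sum_ix Rmat.simps, simplified scalar_mult scalar_diff mult.assoc scalar_qpar_inverse, simplified scalar_mult mult.assoc]
  gen_act_nth[of "inverse qpar" One Two _ One One, unfolded sum_ix Rmat.simps, simplified scalar_mult scalar_diff mult.assoc scalar_qpar_inverse, simplified scalar_mult mult.assoc]
  gen_act_nth[of "inverse qpar" One Two _ One Two, unfolded sum_ix Rmat.simps, simplified scalar_mult scalar_diff mult.assoc scalar_qpar_inverse, simplified scalar_mult mult.assoc]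
  gen_act_nth[of "inverse qpar" One Two _ Two One, unfolded sum_ix Rmat.simps, simplified scalar_mult scalar_diff mult.assoc scalar_qpar_inverse, simplified scalar_mult mult.assoc]
  gen_act_nth[of "inverse qpar" One Two _ Two Two, unfolded sum_ix Rmat.simps, simplified scalar_mult scalar_diff mult.assoc scalar_qpar_inverse, simplified scalar_mult mult.assoc]
  gen_act_nth[of "inverse qpar" Two One _ One One, unfolded sum_ix Rmat.simps, simplified scalar_mult scalar_diff mult.assoc scalar_qpar_inverse, simplified scalar_mult mult.assoc]
  gen_act_nth[of "inverse qpar" Two One _ One Two, unfolded sum_ix Rmat.simps, simplified scalar_mult scalar_diff mult.assoc scalar_qpar_inverse, simplified scalar_mult mult.assoc]
  gen_act_nth[of "inverse qpar" Two One _ Two One, unfolded sum_ix Rmat.simps, simplified scalar_mult scalar_diff mult.assoc scalar_qpar_inverse, simplified scalar_mult mult.assoc]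
  gen_act_nth[of "inverse qpar" Two One _ Two Two, unfolded sum_ix Rmat.simps, simplified scalar_mult scalar_diff mult.assoc scalar_qpar_inverse, simplified scalar_mult mult.assoc]
  gen_act_nth[of "inverse qpar" Two Two _ One One, unfolded sum_ix Rmat.simps, simplified scalar_mult scalar_diff mult.assoc scalar_qpar_inverse, simplified scalar_mult mult.assoc]
  gen_act_nth[of "inverse qpar" Two Two _ One Two, unfolded sum_ix Rmat.simps, simplified scalar_mult scalar_diff mult.assoc scalar_qpar_inverse, simplified scalar_mult mult.assoc]
  gen_act_nth[of "inverse qpar" Two Two _ Two One, unfolded sum_ix Rmat.simps, simplified scalar_mult scalar_diff mult.assoc scalar_qpar_inverse, simplified scalar_mult mult.assoc]
  gen_act_nth[of "inverse qpar" Two Two _ Two Two, unfolded sum_ix Rmat.simps, simplified scalar_mult scalar_diff mult.assoc scalar_qpar_inverse, simplified scalar_mult mult.assoc]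

lemma gen_act_relations_q:
  fixes i j :: ix
  defines "G \<equiv> \<lambda>a b c d. gen_act qpar (c, d) (gen_act qpar (a, b) (dx i j))"
  shows
    "G One One One Two = G One Two One One"
    "G Two One Two Two = G Two Two Two One"
    "(G One One Two Two - G Two Two One One) + (G Two One One Two - G One Two Two One) = 0"
    "G One One Two One = scalar (inverse (qpar^2)) *s G Two One One One"
    "G One Two Two Two = scalar (inverse (qpar^2)) *s G Two Two One Two"
    "G Two One One Two = scalar (qpar^2) *s G One Two Two One"
  unfolding G_def form_eq_iff all_ix vector_minus_component vector_add_component
    vector_smult_component zero_index scalar_power2
  by (cases i; cases j; simp add: gen_act_q dx_nth
    scalar_mult scalar_diff xgen_normal scalar_move scalar_qpar_inverse algebra_simps
    del: qmat.scale_scale)+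

lemma gen_act_relations_iq:
  fixes i j :: ix
  defines "G \<equiv> \<lambda>a b c d. gen_act (inverse qpar) (c, d) (gen_act (inverse qpar) (a, b) (dx i j))"
  shows
    "G One One One Two = G One Two One One"
    "G Two One Two Two = G Two Two Two One"
    "(G One One Two Two - G Two Two One One) + (G Two One One Two - G One Two Two One) = 0"
    "G One One Two One = scalar (inverse (qpar^2)) *s G Two One One One"
    "G One Two Two Two = scalar (inverse (qpar^2)) *s G Two Two One Two"
    "G Two One One Two = scalar (qpar^2) *s G One Two Two One"
  unfolding G_def form_eq_iff all_ix vector_minus_component vector_add_component
    vector_smult_component zero_index scalar_power2
  by (cases i; cases j; simp add: gen_act_iq dx_nth
    scalar_mult scalar_diff xgen_normal scalar_move scalar_qpar_inverse algebra_simps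
    del: qmat.scale_scale)+

lemma free_act_relator_dx:
  assumes p: "p = qpar \<or> p = inverse qpar" and r: "r \<in> relators"
  shows "free_act p (dx i j) r = 0"
  using p
proof
  assume p: "p = qpar"
  show ?thesis
    using r gen_act_relations_q[of i j]
    by (auto simp: p relators_def Let_def free_act_diff free_act_add_right free_act_mult
      free_act_X free_act_const gen_act_smult)
next
  assume p: "p = inverse qpar"
  show ?thesis
    using r gen_act_relations_iq[of i j]
    by (auto simp: p relators_def Let_def free_act_diff free_act_add_right free_act_mult
      free_act_X free_act_const gen_act_smult)
qed

subsection \<open>The right action of the quotient\<close>

lemma form_expand: "\<omega> = (\<Sum>r\<in>UNIV. \<Sum>s\<in>UNIV. (\<omega> $ (r, s)) *s dx r s)"
  unfolding dx_def sum.cartesian_product UNIV_Times_UNIV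
  by (subst basis_expansion[symmetric]) (simp add: case_prod_beta)

lemma free_act_relator:
  assumes "p = qpar \<or> p = inverse qpar" "r \<in> relators"
  shows "free_act p \<omega> r = 0"
  by (subst form_expand)
     (simp add: sum_ix free_act_add_left free_act_smult free_act_relator_dx[OF assms])

lemma free_act_rel_ideal:
  assumes p: "p = qpar \<or> p = inverse qpar"
  shows "f \<in> rel_ideal \<Longrightarrow> free_act p \<omega> f = 0"
  by (induction arbitrary: \<omega> rule: rel_ideal.induct)
     (simp_all add: free_act_zero_right free_act_zero_left free_act_relator[OF p]
        free_act_add_right free_act_mult)

definition qmat_act :: "cq \<Rightarrow> form \<Rightarrow> qmat \<Rightarrow> form" where
  "qmat_act p \<omega> f = free_act p \<omega> (rep_qmat f)"

lemma qmat_act_abs: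
  assumes p: "p = qpar \<or> p = inverse qpar"
  shows "qmat_act p \<omega> (abs_qmat f) = free_act p \<omega> f"
proof -
  have "rep_qmat (abs_qmat f) - f \<in> rel_ideal"
    by (rule Quotient3_rep_abs[OF Quotient3_qmat]) (simp add: rel_ideal.zero)
  from free_act_rel_ideal[OF p this] show ?thesis
    by (simp add: qmat_act_def free_act_diff)
qed

lemma qmat_abs_cases: obtains f' where "f = abs_qmat f'"
  using that[of "rep_qmat f"] by (simp add: Quotient3_abs_rep[OF Quotient3_qmat])

lemma right_action_qmat_act:
  assumes p: "p = qpar \<or> p = inverse qpar"
  shows "right_action p (qmat_act p)"
  unfolding right_action_def
proof (intro conjI allI)
  note abs = qmat_act_abs[OF p]
  fix \<omega> \<eta> :: form and f g :: qmat and c :: cq and i j k l :: ix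
  obtain f' g' where fg: "f = abs_qmat f'" "g = abs_qmat g'"
    by (meson qmat_abs_cases)
  show "qmat_act p (\<omega> + \<eta>) f = qmat_act p \<omega> f + qmat_act p \<eta> f"
    by (simp add: fg abs free_act_add_left)
  show "qmat_act p \<omega> (f + g) = qmat_act p \<omega> f + qmat_act p \<omega> g"
    by (simp add: fg abs plus_qmat.abs_eq free_act_add_right)
  show "qmat_act p \<omega> (f * g) = qmat_act p (qmat_act p \<omega> f) g"
    by (simp add: fg abs times_qmat.abs_eq free_act_mult)
  show "qmat_act p \<omega> (scalar c) = scalar c *s \<omega>"
    by (simp add: scalar.abs_eq[of c] abs free_act_const)
  show "qmat_act p (f *s \<omega>) g = f *s qmat_act p \<omega> g"
    by (simp add: fg(2) abs free_act_smult)
  show "qmat_act p (dx j l) (xgen i k) =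
      (\<Sum>m\<in>UNIV. \<Sum>n\<in>UNIV. \<Sum>a\<in>UNIV. \<Sum>b\<in>UNIV.
        qscale (Rmat p (i, j) (m, n) * Rmat p (b, a) (l, k)) (xgen m a) *s dx n b)"
    by (simp add: xgen.abs_eq[of i k] abs free_act_X gen_act_dx)
       (simp add: cross_def xgen.abs_eq)
qed

lemma right_action_unique:
  assumes "right_action p act" "right_action p act'"
  shows "act = act'"
proof (intro ext)
  fix \<omega> :: form and f :: qmat
  show "act \<omega> f = act' \<omega> f"
  proof (induction f arbitrary: \<omega> rule: qmat_induct)
    case (x r s)
    have "act (\<Sum>i\<in>UNIV. \<Sum>j\<in>UNIV. (\<omega> $ (i, j)) *s dx i j) (xgen r s)
        = act' (\<Sum>i\<in>UNIV. \<Sum>j\<in>UNIV. (\<omega> $ (i, j)) *s dx i j) (xgen r s)"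
      using assms by (simp only: right_action_def sum_ix)
    then show ?case by (simp only: form_expand[symmetric])
  qed (use assms in \<open>simp_all add: right_action_def\<close>)
qed

theorem right_action_ex1:
  assumes "p = qpar \<or> p = inverse qpar"
  shows "\<exists>!act. right_action p act"
  using right_action_qmat_act[OF assms] right_action_unique by blast

lemma rmult_eq:
  assumes "p = qpar \<or> p = inverse qpar"
  shows "rmult p = qmat_act p"
  unfolding rmult_def
  using right_action_qmat_act[OF assms] right_action_unique by blast

theorem right_action_rmult:
  assumes "p = qpar \<or> p = inverse qpar"
  shows "right_action p (rmult p)"
  using right_action_qmat_act[OF assms] by (simp add: rmult_eq[OF assms])


theorem form_universal:
  fixes la :: "qmat \<Rightarrow> 'b \<Rightarrow> 'b :: ab_group_add" and ra :: "'b \<Rightarrow> qmat \<Rightarrow> 'b"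
    and \<beta> :: "ix \<Rightarrow> ix \<Rightarrow> 'b"
  assumes p: "p = qpar \<or> p = inverse qpar"
    and la: "\<And>f u v. la f (u + v) = la f u + la f v" "\<And>f g u. la (f + g) u = la f u + la g u"
      "\<And>f g u. la (f * g) u = la f (la g u)" "\<And>u. la 1 u = u"
    and ra: "\<And>f u v. ra (u + v) f = ra u f + ra v f" "\<And>f g u. ra u (f + g) = ra u f + ra u g"
      "\<And>f g u. ra u (f * g) = ra (ra u f) g"
    and bi: "\<And>f g u. ra (la f u) g = la f (ra u g)" "\<And>c u. ra u (scalar c) = la (scalar c) u"
    and rel: "\<And>i j k l. ra (\<beta> j l) (xgen i k) =
      (\<Sum>m\<in>UNIV. \<Sum>n\<in>UNIV. \<Sum>a\<in>UNIV. \<Sum>b\<in>UNIV.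
        la (qscale (Rmat p (i, j) (m, n) * Rmat p (b, a) (l, k)) (xgen m a)) (\<beta> n b))"
  shows "\<exists>!\<Phi>. (\<forall>\<omega> \<eta>. \<Phi> (\<omega> + \<eta>) = \<Phi> \<omega> + \<Phi> \<eta>) \<and> (\<forall>f \<omega>. \<Phi> (f *s \<omega>) = la f (\<Phi> \<omega>)) \<and>
    (\<forall>\<omega> f. \<Phi> (rmult p \<omega> f) = ra (\<Phi> \<omega>) f) \<and> (\<forall>r s. \<Phi> (dx r s) = \<beta> r s)"
proof (rule ex1I)
  define \<Phi> where "\<Phi> \<omega> = (\<Sum>r\<in>UNIV. \<Sum>s\<in>UNIV. la (\<omega> $ (r, s)) (\<beta> r s))" for \<omega> :: form
  note act = right_action_rmult[OF p, unfolded right_action_def]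
  have la0: "la 0 u = 0" for u using la(2)[of 0 0 u] by simp
  have add: "\<Phi> (\<omega> + \<eta>) = \<Phi> \<omega> + \<Phi> \<eta>" for \<omega> \<eta>
    by (simp add: \<Phi>_def la sum.distrib)
  have smult: "\<Phi> (f *s \<omega>) = la f (\<Phi> \<omega>)" for f \<omega>
    by (simp add: \<Phi>_def la sum_ix)
  have dx: "\<Phi> (dx r s) = \<beta> r s" for r s
    by (cases r; cases s; simp add: \<Phi>_def sum_ix dx_nth la la0)
  have gen: "\<Phi> (rmult p (dx j l) (xgen i k)) = ra (\<beta> j l) (xgen i k)" for i j k l
    unfolding rel using act by (simp only: sum_ix add smult dx)
  have "\<Phi> (rmult p \<omega> f) = ra (\<Phi> \<omega>) f" for \<omega> f
  proof (induction f arbitrary: \<omega> rule: qmat_induct)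
    case (scalar c)
    then show ?case using act bi by (simp add: smult)
  next
    case (x r s)
    have 1: "rmult p \<omega> (xgen r s) =
        (\<Sum>i\<in>UNIV. \<Sum>j\<in>UNIV. (\<omega> $ (i, j)) *s rmult p (dx i j) (xgen r s))"
      by (subst form_expand[of \<omega>], simp only: sum_ix act)
    show ?case
      unfolding 1 by (simp only: \<Phi>_def[of \<omega>] sum_ix add smult gen ra bi)
  next
    case (add f g)
    then show ?case using act \<open>\<And>\<omega> \<eta>. \<Phi> (\<omega> + \<eta>) = \<Phi> \<omega> + \<Phi> \<eta>\<close> by (simp add: ra)
  next
    case (mult f g)
    then show ?case using act by (simp add: ra)
  qed
  then show "(\<forall>\<omega> \<eta>. \<Phi> (\<omega> + \<eta>) = \<Phi> \<omega> + \<Phi> \<eta>) \<and> (\<forall>f \<omega>. \<Phi> (f *s \<omega>) = la f (\<Phi> \<omega>)) \<and>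
    (\<forall>\<omega> f. \<Phi> (rmult p \<omega> f) = ra (\<Phi> \<omega>) f) \<and> (\<forall>r s. \<Phi> (dx r s) = \<beta> r s)"
    using add smult dx by blast
  fix \<Psi> :: "form \<Rightarrow> 'b"
  assume \<Psi>: "(\<forall>\<omega> \<eta>. \<Psi> (\<omega> + \<eta>) = \<Psi> \<omega> + \<Psi> \<eta>) \<and> (\<forall>f \<omega>. \<Psi> (f *s \<omega>) = la f (\<Psi> \<omega>)) \<and>
    (\<forall>\<omega> f. \<Psi> (rmult p \<omega> f) = ra (\<Psi> \<omega>) f) \<and> (\<forall>r s. \<Psi> (dx r s) = \<beta> r s)"
  show "\<Psi> = \<Phi>"
  proof
    fix \<omega>
    have "\<Psi> \<omega> = \<Psi> (\<Sum>r\<in>UNIV. \<Sum>s\<in>UNIV. (\<omega> $ (r, s)) *s dx r s)"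
      by (simp only: form_expand[symmetric])
    also have "\<dots> = \<Phi> \<omega>"
      using \<Psi> by (simp only: \<Phi>_def sum_ix)
    finally show "\<Psi> \<omega> = \<Phi> \<omega>" .
  qed
qed


subsection \<open>The de Rham operator\<close>

fun list_d :: "cq \<Rightarrow> gen list \<Rightarrow> form" where
  "list_d p [] = 0"
| "list_d p (g # w) = fold (gen_act p) w (dx (fst g) (snd g)) + xgen (fst g) (snd g) *s list_d p w"

fun word_d :: "cq \<Rightarrow> word \<Rightarrow> form" where
  "word_d p (Word w) = list_d p w"

definition free_d :: "cq \<Rightarrow> free \<Rightarrow> form" where
  "free_d p = lin_ext (word_d p)"

lemma free_d_single: "free_d p (Poly_Mapping.single w c) = scalar c *s word_d p w"
  by (simp add: free_d_def lin_ext_single)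

lemma free_d_add: "free_d p (f + g) = free_d p f + free_d p g"
  by (simp add: free_d_def lin_ext_add)

lemma free_d_diff: "free_d p (f - g) = free_d p f - free_d p g"
  using free_d_add[of p "f - g" g] by (simp add: algebra_simps)

lemma free_d_zero: "free_d p 0 = 0"
  using free_d_diff[of p 0 0] by simp

abbreviation mono_qmat :: "gen list \<Rightarrow> qmat" where
  "mono_qmat w \<equiv> abs_qmat (Poly_Mapping.single (Word w) 1)"

lemma mono_qmat_Cons: "mono_qmat (g # w) = xgen (fst g) (snd g) * mono_qmat w"
  by (simp add: xgen.abs_eq X_free_def times_qmat.abs_eq mult_single)

lemma mono_qmat_Nil: "mono_qmat [] = 1"
  by (simp add: one_qmat.abs_eq flip: zero_word_def)

lemma abs_qmat_single: "abs_qmat (Poly_Mapping.single (Word w) c) = qscale c (mono_qmat w)"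
  by (simp add: scalar.abs_eq times_qmat.abs_eq const_free_mult_single)

lemma list_d_append:
  "list_d p (u @ v) = fold (gen_act p) v (list_d p u) + mono_qmat u *s list_d p v"
proof (induction u)
  case Nil
  have "fold (gen_act p) v 0 = 0"
    using fold_gen_act_smult[of p v 0 0] by simp
  then show ?case by (simp add: mono_qmat_Nil)
next
  case (Cons g u)
  then show ?case
    by (simp add: fold_gen_act_add fold_gen_act_smult vector_add_ldistrib vector_smult_assoc
        mono_qmat_Cons)
qed

lemma free_d_mult: "free_d p (f * g) = free_act p (free_d p f) g + abs_qmat f *s free_d p g"
proof (induction f rule: free_induct)
  case (1 u c)
  show ?case
  proof (induction g rule: free_induct)
    case (1 v e)
    obtain u' v' where uv: "u = Word u'" "v = Word v'" by (cases u; cases v)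
    have 1: "scalar e *s (scalar c *s \<omega>) = scalar (c * e) *s \<omega>" for \<omega> :: form
      by (simp only: vector_smult_assoc mult.commute[of c e] scalar_mult)
    have "qscale c m * scalar e = scalar (c * e) * m" for m
      by (simp only: mult.assoc scalar_central[of m] scalar_mult)
    then have 2: "qscale c m *s (scalar e *s \<omega>) = scalar (c * e) *s (m *s \<omega>)" for m and \<omega> :: form
      unfolding vector_smult_assoc by simp
    show ?case
      by (simp only: uv mult_single free_d_single free_act_single list_d_append fold_gen_act_smult
          vector_add_ldistrib abs_qmat_single[of u' c] plus_word.simps word_d.simps word_act.simps 1 2)
  next
    case (2 f g)
    then show ?case
      by (simp add: distrib_left free_d_add free_act_add_right vector_add_ldistrib)
  qed
next
  case (2 f g)
  then show ?case
    by (simp add: distrib_right free_d_add free_act_add_left vector_sadd_rdistrib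
        flip: plus_qmat.abs_eq)
qed

lemma free_d_X: "free_d p (X_free r s) = dx r s"
  by (simp add: X_free_def free_d_single)

lemma free_d_const: "free_d p (const_free c) = 0"
  by (simp add: const_free_def free_d_single zero_word_def)

lemma free_d_relator:
  assumes p: "p = qpar \<or> p = inverse qpar" and r: "r \<in> relators"
  shows "free_d p r = 0"
proof -
  have d2: "free_d p (X_free i j * X_free k l) = gen_act p (k, l) (dx i j) + xgen i j *s dx k l"
    for p i j k l
    by (simp add: free_d_mult free_d_X free_act_X flip: xgen.abs_eq)
  have dc: "free_d p (const_free c * f) = scalar c *s free_d p f" for p c f
    by (simp add: free_d_mult free_d_const free_act_zero_left flip: scalar.abs_eq)
  have "\<forall>r\<in>relators. free_d p r = 0"
    using p
  proof
    assume p: "p = qpar"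
    show ?thesis
      unfolding p relators_def Let_def ball_simps
      by (simp add: free_d_diff free_d_add d2 dc form_eq_iff all_ix gen_act_q dx_nth scalar_power2
          scalar_mult scalar_diff xgen_normal scalar_move scalar_qpar_inverse algebra_simps
          del: qmat.scale_scale)
  next
    assume p: "p = inverse qpar"
    show ?thesis
      unfolding p relators_def Let_def ball_simps
      by (simp add: free_d_diff free_d_add d2 dc form_eq_iff all_ix gen_act_iq dx_nth scalar_power2
          scalar_mult scalar_diff xgen_normal scalar_move scalar_qpar_inverse algebra_simps
          del: qmat.scale_scale)
  qed
  then show ?thesis using r by blast
qed

lemma abs_qmat_rel_ideal: "f \<in> rel_ideal \<Longrightarrow> abs_qmat f = 0"
  by (simp add: zero_qmat.abs_eq qmat.abs_eq_iff)

lemma free_d_rel_ideal: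
  assumes p: "p = qpar \<or> p = inverse qpar"
  shows "f \<in> rel_ideal \<Longrightarrow> free_d p f = 0"
  by (induction rule: rel_ideal.induct)
     (simp_all add: free_d_zero free_d_relator[OF p] free_d_add free_d_mult
        free_act_rel_ideal[OF p] free_act_zero_left abs_qmat_rel_ideal)

definition qmat_d :: "cq \<Rightarrow> qmat \<Rightarrow> form" where
  "qmat_d p f = free_d p (rep_qmat f)"

lemma qmat_d_abs:
  assumes p: "p = qpar \<or> p = inverse qpar"
  shows "qmat_d p (abs_qmat f) = free_d p f"
proof -
  have "rep_qmat (abs_qmat f) - f \<in> rel_ideal"
    by (rule Quotient3_rep_abs[OF Quotient3_qmat]) (simp add: rel_ideal.zero)
  from free_d_rel_ideal[OF p this] show ?thesis
    by (simp add: qmat_d_def free_d_diff)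
qed

lemma de_Rham_qmat_d:
  assumes p: "p = qpar \<or> p = inverse qpar"
  shows "de_Rham p (qmat_d p)"
  unfolding de_Rham_def rmult_eq[OF p]
proof (intro conjI allI)
  note abs = qmat_d_abs[OF p] qmat_act_abs[OF p]
  fix f g :: qmat and c :: cq and r s :: ix
  obtain f' g' where fg: "f = abs_qmat f'" "g = abs_qmat g'"
    by (meson qmat_abs_cases)
  show "qmat_d p (f + g) = qmat_d p f + qmat_d p g"
    by (simp add: fg abs plus_qmat.abs_eq free_d_add)
  show "qmat_d p (qscale c f) = scalar c *s qmat_d p f"
    unfolding scalar.abs_eq[of c] fg(1) times_qmat.abs_eq abs free_d_mult free_d_const
      free_act_zero_left by simp
  show "qmat_d p (xgen r s) = dx r s"
    by (simp add: xgen.abs_eq abs free_d_X)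
  show "qmat_d p (f * g) = qmat_act p (qmat_d p f) g + f *s qmat_d p g"
    by (simp add: fg abs times_qmat.abs_eq free_d_mult)
qed

lemma de_Rham_unique:
  assumes p: "p = qpar \<or> p = inverse qpar" and D: "de_Rham p D" "de_Rham p D'"
  shows "D = D'"
proof
  note act = right_action_rmult[OF p, unfolded right_action_def]
  have one: "E 1 = 0" if "de_Rham p E" for E
  proof -
    have "E (1 * 1) = rmult p (E 1) (scalar 1) + 1 *s E 1"
      using that unfolding de_Rham_def scalar_1 by blast
    moreover have "rmult p (E 1) (scalar 1) = scalar 1 *s E 1"
      using act by blast
    ultimately show ?thesis by simp
  qed
  fix f
  show "D f = D' f"
  proof (induction f rule: qmat_induct)
    case (scalar c)
    have "E (scalar c) = 0" if "de_Rham p E" for E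
    proof -
      have "E (qscale c 1) = scalar c *s E 1"
        using that unfolding de_Rham_def by blast
      then show ?thesis using one[OF that] by simp
    qed
    from this[OF D(1)] this[OF D(2)] show ?case by simp
  qed (use D in \<open>simp_all add: de_Rham_def\<close>)
qed

theorem de_Rham_ex1:
  assumes "p = qpar \<or> p = inverse qpar"
  shows "\<exists>!D. de_Rham p D"
  using de_Rham_qmat_d[OF assms] de_Rham_unique[OF assms] by blast

theorem de_Rham_ext_d:
  assumes "p = qpar \<or> p = inverse qpar"
  shows "de_Rham p (ext_d p)"
  unfolding ext_d_def by (rule theI'[OF de_Rham_ex1[OF assms]])


end

theory Submission
  imports Defs
begin

unbundle no fps_syntax

text \<open>
  Let \<open>N = x\<^sub>1\<^sub>1 x\<^sub>2\<^sub>2 - x\<^sub>1\<^sub>2 x\<^sub>2\<^sub>1\<close> be the quantum determinant, which commutes with the generators up to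
  powers of \<open>q\<close>, and let \<open>E f = \<Sum> (\<partial>\<^sub>r\<^sub>s f) x\<^sub>r\<^sub>s\<close> be the right Euler operator.  Then
  \<open>\<box>(f N) = p\<^sup>-\<^sup>4 (\<box> f) N + (1 + p\<^sup>2) f + p\<^sup>-\<^sup>2 E f\<close> and \<open>E(f N) = p\<^sup>-\<^sup>2 (E f) N + (1 + p\<^sup>2) f N\<close>.
  For \<open>s\<close> specialised to a scalar, \<open>u = x\<^sub>1\<^sub>1 s + x\<^sub>2\<^sub>1\<close> and \<open>v = x\<^sub>1\<^sub>2 s + x\<^sub>2\<^sub>2\<close> commute, and every polynomial
  \<open>F\<close> in \<open>u, v\<close> satisfies \<open>\<partial>\<^sub>1\<^sub>k F = s \<partial>\<^sub>2\<^sub>k F\<close> with \<open>\<partial>\<^sub>2\<^sub>k F\<close> again such a polynomial, whence \<open>\<box> F = 0\<close>;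
  moreover \<open>E\<close> acts on the homogeneous ones by a q-number.  Comparing coefficients of \<open>s\<close>, the same
  holds for the elements \<open>X\<close>, so \<open>\<box>(X N\<^sup>k\<^sup>+\<^sup>1)\<close> is a nonzero multiple of \<open>X N\<^sup>k\<close>.

  Modulo \<open>N\<close> any two words with the same numbers of row and column indices are proportional, and
  \<open>X\<close> becomes a nonzero multiple of such a word (a q-binomial coefficient).  Hence the \<open>X N\<^sup>k\<close> span.
  The coefficients modulo \<open>N\<close> composed with \<open>\<box>\<^sup>k\<close> are functionals dual to the \<open>X N\<^sup>k\<close>, so these form
  a basis, and the kernel of \<open>\<box>\<close> is spanned by those with \<open>k = 0\<close>.
\<close>

section \<open>The differential calculus and the quantum determinant\<close>

lemma xgen_normal_left:
  "xgen One Two * (xgen One One * f) = xgen One One * (xgen One Two * f)"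
  "xgen Two Two * (xgen Two One * f) = xgen Two One * (xgen Two Two * f)"
  "xgen Two One * (xgen One One * f) = scalar qpar * (scalar qpar * (xgen One One * (xgen Two One * f)))"
  "xgen Two Two * (xgen One Two * f) = scalar qpar * (scalar qpar * (xgen One Two * (xgen Two Two * f)))"
  "xgen Two One * (xgen One Two * f) = scalar qpar * (scalar qpar * (xgen One Two * (xgen Two One * f)))"
  "xgen Two Two * (xgen One One * f) = xgen One One * (xgen Two Two * f)
     + scalar qpar * (scalar qpar * (xgen One Two * (xgen Two One * f))) - xgen One Two * (xgen Two One * f)"
  using xgen_normal[THEN arg_cong, of "\<lambda>g. g * f"] by (simp_all add: algebra_simps)

definition detq :: qmat where
  "detq = xgen One One * xgen Two Two - xgen One Two * xgen Two One"

text \<open>The factor in \<open>dx r s\<close> times \<open>detq\<close> =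
  \<open>det_wt p r s\<close> times \<open>detq\<close> times \<open>dx r s\<close>: it is p^-2
  times the factor with which \<open>xgen r s\<close> itself passes \<open>detq\<close>.\<close>

fun det_wt :: "cq \<Rightarrow> ix \<Rightarrow> ix \<Rightarrow> cq" where
  "det_wt p One One = inverse (p^2)"
| "det_wt p One Two = inverse (p^2) * inverse (qpar^2)"
| "det_wt p Two One = inverse (p^2) * qpar^2"
| "det_wt p Two Two = inverse (p^2)"

locale quantum_calculus =
  fixes p :: cq
  assumes p: "p = qpar \<or> p = inverse qpar"
begin

abbreviation D :: "ix \<Rightarrow> ix \<Rightarrow> qmat \<Rightarrow> qmat" where
  "D \<equiv> partial p"

lemma de_Rham_rules:
  "ext_d p (f + g) = ext_d p f + ext_d p g"
  "ext_d p (qscale c f) = scalar c *s ext_d p f"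
  "ext_d p (xgen r s) = dx r s"
  "ext_d p (f * g) = qmat_act p (ext_d p f) g + f *s ext_d p g"
  using de_Rham_ext_d[OF p] unfolding de_Rham_def rmult_eq[OF p] by blast+

lemma D_add: "D r s (f + g) = D r s f + D r s g"
  by (simp only: partial_def de_Rham_rules(1) vector_add_component)

lemma D_scale: "D r s (qscale c f) = qscale c (D r s f)"
  by (simp only: partial_def de_Rham_rules(2) vector_smult_component)

lemma D_diff: "D r s (f - g) = D r s f - D r s g"
  using D_add[of r s "f - g" g] by (simp add: algebra_simps)

lemma D_zero: "D r s 0 = 0"
  using D_diff[of r s 0 0] by simp

lemma act_rules:
  "qmat_act p \<omega> (f + g) = qmat_act p \<omega> f + qmat_act p \<omega> g"
  "qmat_act p (\<omega> + \<eta>) f = qmat_act p \<omega> f + qmat_act p \<eta> f"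
  "qmat_act p \<omega> (f * g) = qmat_act p (qmat_act p \<omega> f) g"
  "qmat_act p (f *s \<omega>) g = f *s qmat_act p \<omega> g"
  "qmat_act p \<omega> (scalar c) = scalar c *s \<omega>"
  using right_action_qmat_act[OF p] unfolding right_action_def by blast+

lemma ext_d_one: "ext_d p 1 = 0"
  using de_Rham_rules(4)[of 1 1] act_rules(5)[of "ext_d p 1" 1] by simp

lemma D_one: "D r s 1 = 0"
  by (simp add: partial_def ext_d_one)

lemma qmat_act_xgen: "qmat_act p \<omega> (xgen r s) = gen_act p (r, s) \<omega>"
  by (simp add: xgen.abs_eq qmat_act_abs[OF p] free_act_X)

lemma D_mult_xgen:
  "D n b (f * xgen i k) = gen_act p (i, k) (ext_d p f) $ (n, b) + (if n = i \<and> b = k then f else 0)"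
  by (simp add: partial_def de_Rham_rules qmat_act_xgen dx_nth)

lemma act_diff: "qmat_act p \<omega> (f - g) = qmat_act p \<omega> f - qmat_act p \<omega> g"
  using act_rules(1)[of \<omega> "f - g" g] by (simp add: algebra_simps)

lemma act_detq_dx: "qmat_act p (dx r s) detq = (scalar (det_wt p r s) * detq) *s dx r s"
  unfolding detq_def act_diff act_rules qmat_act_xgen form_eq_iff all_ix using p
  by (elim disjE; cases r; cases s; simp add: gen_act_q gen_act_iq dx_nth power2_eq_square
    scalar_mult scalar_diff xgen_normal scalar_move scalar_qpar_inverse algebra_simps
    del: qmat.scale_scale)

lemma act_detq: "qmat_act p \<omega> detq $ (r, s) = qscale (det_wt p r s) (\<omega> $ (r, s) * detq)"
proof -
  have "qmat_act p \<omega> detq = qmat_act p (\<Sum>i\<in>UNIV. \<Sum>j\<in>UNIV. (\<omega> $ (i, j)) *s dx i j) detq"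
    by (simp only: form_expand[symmetric])
  also have "\<dots> = (\<Sum>i\<in>UNIV. \<Sum>j\<in>UNIV. (\<omega> $ (i, j) * (scalar (det_wt p i j) * detq)) *s dx i j)"
    by (simp only: sum_ix act_rules act_detq_dx vector_smult_assoc)
  finally show ?thesis
    by (cases r; cases s; simp add: sum_ix dx_nth scalar_left_commute)
qed

lemma D_detq:
  "D One One detq = qscale (p * inverse qpar) (xgen Two Two)"
  "D One Two detq = - qscale (p * inverse qpar) (xgen Two One)"
  "D Two One detq = - qscale (p * qpar) (xgen One Two)"
  "D Two Two detq = qscale (p * qpar) (xgen One One)"
  unfolding detq_def D_diff D_mult_xgen de_Rham_rules using p
  by (auto simp add: gen_act_q gen_act_iq dx_nth power2_eq_square
    scalar_mult scalar_diff xgen_normal scalar_move scalar_qpar_inverse algebra_simps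
    simp del: qmat.scale_scale)

lemma D_mult_detq:
  "D r s (f * detq) = qscale (det_wt p r s) (D r s f * detq) + f * D r s detq"
  by (simp add: partial_def de_Rham_rules act_detq)

section \<open>The Euler operator and the Laplacian on multiples of the determinant\<close>

definition euler :: "qmat \<Rightarrow> qmat" where
  "euler f = (\<Sum>r\<in>UNIV. \<Sum>s\<in>UNIV. D r s f * xgen r s)"

text \<open>The q-powers in the weight of \<open>dx r s\<close> cancel those from moving
  \<open>xgen r s\<close> past \<open>detq\<close>, so all four terms of
  \<open>euler (f * detq)\<close> acquire the same factor p^-2.\<close>

lemma detq_xgen:
  "qscale (det_wt p r s) (detq * xgen r s) = qscale (inverse (p^2)) (xgen r s * detq)"
  using p
  by (elim disjE; cases r; cases s; simp add: detq_def xgen_normal xgen_normal_left scalar_mult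
    scalar_diff scalar_move scalar_qpar_inverse power2_eq_square algebra_simps
    del: qmat.scale_scale)

lemma euler_of_detq: "euler detq = qscale (1 + p^2) detq"
  unfolding euler_def sum_ix D_detq using p
  by (auto simp add: detq_def power2_eq_square
    scalar_mult scalar_add xgen_normal scalar_move scalar_qpar_inverse algebra_simps
    simp del: qmat.scale_scale)

lemma euler_detq: "euler (f * detq) =
    qscale (inverse (p^2)) (euler f * detq) + qscale (1 + p^2) (f * detq)"
proof -
  have 1: "qscale (det_wt p r s) (g * detq) * xgen r s = qscale (inverse (p^2)) (g * xgen r s * detq)"
    for g r s
    using detq_xgen[of r s] by (metis mult.assoc scalar_left_commute)
  have "euler (f * detq) = qscale (inverse (p^2)) (euler f * detq) + f * euler detq"
    unfolding euler_def D_mult_detq distrib_right 1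
    by (simp add: sum.distrib sum_distrib_left sum_distrib_right mult.assoc)
  then show ?thesis by (simp only: euler_of_detq scalar_left_commute[of f])
qed

text \<open>The product rule is applied twice. Terms with two derivatives on \<open>f\<close> give
  the Laplacian of \<open>f\<close>; since the derivatives of \<open>detq\<close> are multiples of
  generators, the others are first order and assemble into \<open>euler f\<close> and
  \<open>f\<close>.\<close>

lemma laplacian_detq: "laplacian p (f * detq) = qscale (inverse (p^4)) (laplacian p f * detq)
   + qscale (1 + p^2) f + qscale (inverse (p^2)) (euler f)"
proof -
  let ?D = "\<lambda>i j. ext_d p f $ (i, j)"
  have l: "laplacian p (f * detq) =
      qscale (det_wt p Two Two * det_wt p One One) (D One One (D Two Two f) * detq)
    - qscale (det_wt p One Two * det_wt p Two One) (D Two One (D One Two f) * detq)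
    + qscale (det_wt p Two Two) (D Two Two f * D One One detq)
    - qscale (det_wt p One Two) (D One Two f * D Two One detq)
    + qscale (p * qpar) (D One One (f * xgen One One))
    + qscale (p * inverse qpar) (D Two One (f * xgen Two One))"
    (is "_ = ?a - ?b + ?c - ?d + ?e + ?f")
    unfolding laplacian_def D_mult_detq[of Two Two] D_mult_detq[of One Two] D_detq(2,4) D_add D_scale
      D_mult_detq mult_minus_right scalar_left_commute[of f] D_diff diff_conv_add_uminus[symmetric]
    by (simp add: algebra_simps)
  have w: "det_wt p Two Two * det_wt p One One = inverse (p^4)"
     "det_wt p One Two * det_wt p Two One = inverse (p^4)"
    by (simp_all add: field_simps power_numeral_reduce)
  have "?a - ?b = qscale (inverse (p^4)) (laplacian p f * detq)"
    unfolding w laplacian_def by (simp add: algebra_simps)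
  \<comment> \<open>\<open>D_mult_xgen\<close> takes the outer derivatives in \<open>?e\<close> and
    \<open>?f\<close> past the generator; the resulting first-order terms combine with
    \<open>?c\<close> and \<open>?d\<close>.\<close>
  moreover have "?c - ?d + ?e + ?f = qscale (1 + p^2) f + qscale (inverse (p^2)) (euler f)"
    unfolding D_mult_xgen D_detq euler_def
    unfolding partial_def using p
    by (auto simp add: sum_ix gen_act_q gen_act_iq power2_eq_square
      scalar_mult scalar_add scalar_diff scalar_move scalar_qpar_inverse
      scalar_left_commute[of "ext_d _ f $ _"] algebra_simps
      simp del: qmat.scale_scale)
  ultimately show ?thesis unfolding l by (simp add: algebra_simps)
qed

text \<open>This removes the row R-matrix from the commutation relations once the rows are specialised.\<close>

lemma Rmat_eigenvector:
  fixes s :: "ix \<Rightarrow> cq"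
  shows "(\<Sum>i\<in>UNIV. \<Sum>j\<in>UNIV. s i * s j * Rmat p (i, j) (m, n)) = inverse p * (s m * s n)"
  by (cases m; cases n; simp add: sum_ix algebra_simps)

text \<open>When the rows of \<omega> are proportional to \<open>s\<close> and the generators are
  combined with the same \<open>s\<close>, the row R-matrix meets only its eigenvector. It
  contributes p^-1, and only the column R-matrix survives.\<close>

lemma gen_act_row_ratio:
  fixes s :: "ix \<Rightarrow> cq" and w :: "ix \<Rightarrow> qmat"
  assumes "\<And>r l. \<omega> $ (r, l) = qscale (s r) (w l)"
  shows "(\<Sum>i\<in>UNIV. scalar (s i) *s gen_act p (i, k) \<omega>) $ (n, b) =
    qscale (inverse p * s n) (\<Sum>l\<in>UNIV. \<Sum>a\<in>UNIV. qscale (Rmat p (b, a) (l, k))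
      (w l * (\<Sum>m\<in>UNIV. qscale (s m) (xgen m a))))"
proof -
  have "(\<Sum>i\<in>UNIV. scalar (s i) *s gen_act p (i, k) \<omega>) $ (n, b) =
    (\<Sum>i\<in>UNIV. \<Sum>j\<in>UNIV. \<Sum>l\<in>UNIV. \<Sum>m\<in>UNIV. \<Sum>a\<in>UNIV.
      qscale (s i * s j * Rmat p (i, j) (m, n) * Rmat p (b, a) (l, k)) (w l * xgen m a))"
    by (simp add: gen_act_nth assms sum_distrib_left mult_ac mult.assoc del: Rmat.simps)
  also have "\<dots> = (\<Sum>l\<in>UNIV. \<Sum>a\<in>UNIV. \<Sum>m\<in>UNIV.
     qscale ((\<Sum>i\<in>UNIV. \<Sum>j\<in>UNIV. s i * s j * Rmat p (i, j) (m, n)) * Rmat p (b, a) (l, k)) (w l * xgen m a))"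
    by (simp only: sum_ix distrib_right scalar_add add_ac)
  also have "\<dots> = qscale (inverse p * s n) (\<Sum>l\<in>UNIV. \<Sum>a\<in>UNIV. qscale (Rmat p (b, a) (l, k))
      (w l * (\<Sum>m\<in>UNIV. qscale (s m) (xgen m a))))"
    unfolding Rmat_eigenvector
    by (simp add: sum_distrib_left scalar_left_commute[of "w l" for l] mult_ac mult.assoc del: Rmat.simps)
  finally show ?thesis .
qed

end

section \<open>The generating functions of the elements \<open>X\<^sup>l\<^sub>m\<^sub>n\<close>\<close>

fun row_coeff :: "cq \<Rightarrow> ix \<Rightarrow> cq" where
  "row_coeff \<sigma> One = \<sigma>"
| "row_coeff \<sigma> Two = 1"

text \<open>The column polynomial of the generating function with its variable replaced by a scalar,
  so that it lies in \<open>qmat\<close>, where the derivatives are defined.\<close>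

definition ucol :: "cq \<Rightarrow> ix \<Rightarrow> qmat" where
  "ucol \<sigma> k = (\<Sum>m\<in>UNIV. qscale (row_coeff \<sigma> m) (xgen m k))"

text \<open>Comparing powers of \<sigma>, this is the first, third and second defining relation of
  the algebra.\<close>

lemma ucol_commute: "ucol \<sigma> k * ucol \<sigma> l = ucol \<sigma> l * ucol \<sigma> k"
proof -
  have "ucol \<sigma> One * ucol \<sigma> Two = ucol \<sigma> Two * ucol \<sigma> One"
    by (simp add: ucol_def sum_ix xgen_normal scalar_move algebra_simps del: qmat.scale_scale)
  then show ?thesis by (cases k; cases l; simp)
qed

lemma qpar_power: "qpar ^ n = Fract (monom 1 n) 1"
  by (induction n) (simp_all add: qpar_def One_fract_def monom_altdef one_pCons)

lemma qpar_power_eq_iff: "qpar ^ m = qpar ^ n \<longleftrightarrow> m = n"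
  by (simp add: qpar_power eq_fract monom_eq_iff')

text \<open>Transfers identities known for every scalar value of the variable to the individual
  coefficients; it works because the powers of q are distinct.\<close>

lemma vandermonde_zero:
  assumes "\<And>\<sigma>. (\<Sum>t\<le>n. qscale (\<sigma> ^ t) (w t)) = 0"
  shows "t \<le> n \<Longrightarrow> w t = 0"
  using assms
proof (induction n arbitrary: w t)
  case 0
  then show ?case by simp
next
  case (Suc n)
  \<comment> \<open>Replacing \<open>\<sigma>\<close> by \<open>q \<sigma>\<close> and subtracting \<open>q\<^sup>n\<^sup>+\<^sup>1\<close> times the sum cancels the top term.\<close>
  have "(\<Sum>t\<le>n. qscale (\<sigma> ^ t) (qscale (qpar ^ t - qpar ^ Suc n) (w t))) = 0" for \<sigma>
  proof -
    have "(\<Sum>t\<le>n. qscale (\<sigma> ^ t) (qscale (qpar ^ t - qpar ^ Suc n) (w t)))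
      = (\<Sum>t\<le>Suc n. qscale (\<sigma> ^ t * (qpar ^ t - qpar ^ Suc n)) (w t))"
      by simp
    also have "\<dots> = (\<Sum>t\<le>Suc n. qscale ((qpar * \<sigma>) ^ t) (w t)) - qscale (qpar ^ Suc n) (\<Sum>t\<le>Suc n. qscale (\<sigma> ^ t) (w t))"
      unfolding sum_distrib_left sum_subtractf[symmetric]
      by (intro sum.cong refl) (simp add: power_mult_distrib scalar_diff algebra_simps)
    finally show ?thesis using Suc.prems(2) by simp
  qed
  from Suc.IH[OF _ this] have "qscale (qpar ^ t - qpar ^ Suc n) (w t) = 0" if "t \<le> n" for t
    using that by blast
  moreover have "qpar ^ t - qpar ^ Suc n \<noteq> 0" if "t \<le> n" for t
    using qpar_power_eq_iff[of t "Suc n"] that by simp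
  ultimately have *: "w t = 0" if "t \<le> n" for t
    using that qmat.scale_eq_0_iff by blast
  moreover have "w (Suc n) = 0"
    using Suc.prems(2)[of 1] * by simp
  ultimately show ?case using Suc.prems(1) le_Suc_eq by auto
qed

section \<open>Recursion and specialisation of the coefficients\<close>

definition col_fls :: "ix \<Rightarrow> qmat fls" where
  "col_fls k = fls_const (xgen One k) * fls_X + fls_const (xgen Two k)"

text \<open>\<open>Xcoeff i j t\<close> is \<open>X\<^sup>l\<^sub>m\<^sub>n\<close> for \<open>i = l - m\<close>, \<open>j = l + m\<close>, \<open>t = l - n\<close>.\<close>

definition Xcoeff :: "nat \<Rightarrow> nat \<Rightarrow> nat \<Rightarrow> qmat" where
  "Xcoeff i j t = fls_nth (col_fls One ^ i * col_fls Two ^ j) (int t)"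

lemma fls_nth_mult_col:
  "fls_nth (f * col_fls k) z = fls_nth f (z - 1) * xgen One k + fls_nth f z * xgen Two k"
  by (simp add: col_fls_def distrib_left fls_X_conv_shift_1 fls_shifted_times_simps
     flip: mult.assoc)

lemma fls_nth_col_neg: "z < 0 \<Longrightarrow> fls_nth (col_fls One ^ i * col_fls Two ^ j) z = 0"
proof (induction j arbitrary: z)
  case 0
  then show ?case
  proof (induction i arbitrary: z)
    case (Suc i)
    then show ?case unfolding power_Suc2 by (simp add: fls_nth_mult_col)
  qed simp
next
  case (Suc j)
  then show ?case unfolding power_Suc2 mult.assoc[symmetric] by (simp add: fls_nth_mult_col)
qed

lemma Xcoeff_Suc_right:
  "Xcoeff i (Suc j) t = (case t of 0 \<Rightarrow> 0 | Suc t' \<Rightarrow> Xcoeff i j t' * xgen One Two) + Xcoeff i j t * xgen Two Two"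
  unfolding Xcoeff_def power_Suc2 mult.assoc[symmetric]
  by (simp add: fls_nth_mult_col fls_nth_col_neg split: nat.split)

text \<open>Restricted to \<open>j = 0\<close>: the factors of the first column come first, so one
  of them is the rightmost factor only while the second column is absent.
  \<open>Xcoeff_induct\<close> follows this order.\<close>

lemma Xcoeff_Suc_left:
  "Xcoeff (Suc i) 0 t = (case t of 0 \<Rightarrow> 0 | Suc t' \<Rightarrow> Xcoeff i 0 t' * xgen One One) + Xcoeff i 0 t * xgen Two One"
  unfolding Xcoeff_def power_Suc2
  using fls_nth_col_neg[of _ i 0]
  by (simp add: fls_nth_mult_col split: nat.split)

lemma Xcoeff_0: "Xcoeff 0 0 t = (if t = 0 then 1 else 0)"
  by (simp add: Xcoeff_def)

lemma Xcoeff_induct [case_names zero left right]: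
  assumes "Q 0 0" "\<And>i. Q i 0 \<Longrightarrow> Q (Suc i) 0" "\<And>i j. Q i j \<Longrightarrow> Q i (Suc j)"
  shows "Q i j"
proof (induction j)
  case 0
  show ?case by (induction i) (use assms in auto)
qed (use assms in auto)

lemma Xcoeff_eq_0: "i + j < t \<Longrightarrow> Xcoeff i j t = 0"
  by (induction i j arbitrary: t rule: Xcoeff_induct)
     (auto simp: Xcoeff_0 Xcoeff_Suc_left Xcoeff_Suc_right split: nat.split)

text \<open>The recursion for coefficients, summed against powers of \<sigma>, is right
  multiplication by a column. The assumption removes the top term of the \<open>xgen Two k\<close>
  part, where the sum on the right has already stopped.\<close>

lemma sum_mult_col:
  assumes "F (Suc n) = 0"
  shows "(\<Sum>t\<le>Suc n. qscale (\<sigma> ^ t) ((case t of 0 \<Rightarrow> 0 | Suc t' \<Rightarrow> F t' * xgen One k) + F t * xgen Two k))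
    = (\<Sum>t\<le>n. qscale (\<sigma> ^ t) (F t)) * ucol \<sigma> k"
proof -
  have "(\<Sum>t\<le>Suc n. qscale (\<sigma> ^ t) (case t of 0 \<Rightarrow> 0 | Suc t' \<Rightarrow> F t' * xgen One k))
    = (\<Sum>t\<le>n. qscale (\<sigma> ^ t) (F t) * qscale \<sigma> (xgen One k))"
    unfolding sum.atMost_Suc_shift
    by (simp add: mult.assoc scalar_left_commute[of "F _"] mult.commute[of \<sigma>])
  moreover have "(\<Sum>t\<le>Suc n. qscale (\<sigma> ^ t) (F t * xgen Two k)) = (\<Sum>t\<le>n. qscale (\<sigma> ^ t) (F t) * xgen Two k)"
    using assms by (simp add: mult.assoc)
  ultimately show ?thesis
    by (simp add: distrib_left sum.distrib ucol_def sum_ix sum_distrib_right)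
qed

lemma sum_Xcoeff: "(\<Sum>t\<le>i + j. qscale (\<sigma> ^ t) (Xcoeff i j t)) = ucol \<sigma> One ^ i * ucol \<sigma> Two ^ j"
proof (induction i j rule: Xcoeff_induct)
  case zero
  show ?case by (simp add: Xcoeff_0)
next
  case (left i)
  have "(\<Sum>t\<le>Suc i. qscale (\<sigma> ^ t) (Xcoeff (Suc i) 0 t)) = (\<Sum>t\<le>i. qscale (\<sigma> ^ t) (Xcoeff i 0 t)) * ucol \<sigma> One"
    unfolding Xcoeff_Suc_left by (rule sum_mult_col) (simp add: Xcoeff_eq_0)
  then show ?case using left by (simp add: power_Suc2 del: power_Suc sum.atMost_Suc)
next
  case (right i j)
  have "(\<Sum>t\<le>Suc (i + j). qscale (\<sigma> ^ t) (Xcoeff i (Suc j) t)) = (\<Sum>t\<le>i + j. qscale (\<sigma> ^ t) (Xcoeff i j t)) * ucol \<sigma> Two"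
    unfolding Xcoeff_Suc_right by (rule sum_mult_col) (simp add: Xcoeff_eq_0)
  then show ?case using right by (simp add: power_Suc2 mult.assoc del: power_Suc sum.atMost_Suc)
qed

section \<open>Derivatives of polynomials in the specialised columns\<close>

context quantum_calculus
begin

text \<open>\<open>row_ratio \<sigma>\<close> says that \<open>df\<close> is a left combination of the differentials
  of the two specialised columns \<open>ucol \<sigma> k\<close>; polynomials in these columns have this property.\<close>

definition row_ratio :: "cq \<Rightarrow> qmat \<Rightarrow> bool" where
  "row_ratio \<sigma> f \<longleftrightarrow> (\<forall>k. D One k f = qscale \<sigma> (D Two k f))"

lemma row_ratio_nth: "row_ratio \<sigma> f \<Longrightarrow> D r k f = qscale (row_coeff \<sigma> r) (D Two k f)"
  by (cases r) (simp_all add: row_ratio_def)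

text \<open>By \<open>gen_act_row_ratio\<close> the row index \<open>n\<close> enters only through
  \<open>row_coeff\<close>, so \<open>row_ratio\<close> is inherited by the product. The bracket
  contains only \<open>f\<close> and products of \<open>D Two l f\<close> with columns, which makes
  second derivatives accessible to induction.\<close>

lemma D_mult_ucol:
  assumes "row_ratio \<sigma> f"
  shows "D n b (f * ucol \<sigma> k) = qscale (row_coeff \<sigma> n)
     (qscale (inverse p) (\<Sum>l\<in>UNIV. \<Sum>a\<in>UNIV. qscale (Rmat p (b, a) (l, k)) (D Two l f * ucol \<sigma> a))
      + (if b = k then f else 0))"
proof -
  have nth: "ext_d p f $ (r, l) = qscale (row_coeff \<sigma> r) (D Two l f)" for r l
    unfolding partial_def[symmetric] by (rule row_ratio_nth[OF assms])
  have "D n b (f * ucol \<sigma> k) = (\<Sum>i\<in>UNIV. scalar (row_coeff \<sigma> i) *s gen_act p (i, k) (ext_d p f)) $ (n, b)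
    + qscale (row_coeff \<sigma> n) (if b = k then f else 0)"
    unfolding ucol_def
    by (cases n) (simp_all add: distrib_left sum_ix D_add D_scale D_mult_xgen scalar_left_commute[of f])
  then show ?thesis
    unfolding gen_act_row_ratio[OF nth] ucol_def[symmetric] by (simp add: distrib_left)
qed

lemma row_ratio_add: "row_ratio \<sigma> f \<Longrightarrow> row_ratio \<sigma> g \<Longrightarrow> row_ratio \<sigma> (f + g)"
  unfolding row_ratio_def D_add distrib_left by simp

lemma row_ratio_scale: "row_ratio \<sigma> f \<Longrightarrow> row_ratio \<sigma> (qscale c f)"
  unfolding row_ratio_def D_scale by (simp add: mult.commute)

lemma row_ratio_sum: "(\<And>x. x \<in> A \<Longrightarrow> row_ratio \<sigma> (h x)) \<Longrightarrow> row_ratio \<sigma> (sum h A)"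
  by (induction A rule: infinite_finite_induct) (auto simp: row_ratio_add row_ratio_def[of _ 0] D_zero)

lemma row_ratio_mult_ucol: "row_ratio \<sigma> f \<Longrightarrow> row_ratio \<sigma> (f * ucol \<sigma> k)"
  by (simp add: row_ratio_def[of \<sigma> "f * _"] D_mult_ucol)

text \<open>Both claims are carried together, since the derivatives of
  \<open>f * ucol \<sigma> l\<close> are combinations of \<open>f\<close> and of products
  \<open>D Two l' f * ucol \<sigma> a\<close>.\<close>

lemma row_ratio_ucol_power:
  "row_ratio \<sigma> (ucol \<sigma> One ^ i * ucol \<sigma> Two ^ j) \<and> (\<forall>k. row_ratio \<sigma> (D Two k (ucol \<sigma> One ^ i * ucol \<sigma> Two ^ j)))"
proof -
  have step: "row_ratio \<sigma> (f * ucol \<sigma> l) \<and> (\<forall>k. row_ratio \<sigma> (D Two k (f * ucol \<sigma> l)))"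
    if f: "row_ratio \<sigma> f \<and> (\<forall>k. row_ratio \<sigma> (D Two k f))" for f l
    using f by (auto simp: D_mult_ucol row_ratio_mult_ucol row_ratio_def[of _ 0] D_zero
      intro!: row_ratio_add row_ratio_scale row_ratio_sum)
  have one: "row_ratio \<sigma> 1 \<and> (\<forall>k. row_ratio \<sigma> (D Two k 1))"
    by (simp add: row_ratio_def D_one D_zero)
  have "row_ratio \<sigma> (ucol \<sigma> One ^ i * 1) \<and> (\<forall>k. row_ratio \<sigma> (D Two k (ucol \<sigma> One ^ i * 1)))"
    by (induction i) (use one step in \<open>simp_all add: power_Suc2 del: power_Suc\<close>)
  then show ?thesis
    by (induction j) (use step in \<open>simp_all add: power_Suc2 mult.assoc[symmetric] del: power_Suc\<close>)
qed

text \<open>Both terms of the Laplacian become \<sigma> times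
  \<open>D Two One (D Two Two f)\<close>.\<close>

lemma laplacian_row_ratio:
  assumes "row_ratio \<sigma> f" "row_ratio \<sigma> (D Two Two f)"
  shows "laplacian p f = 0"
proof -
  have "D One Two f = qscale \<sigma> (D Two Two f)"
    "D One One (D Two Two f) = qscale \<sigma> (D Two One (D Two Two f))"
    using assms by (simp_all add: row_ratio_def)
  then show ?thesis by (simp add: laplacian_def D_scale)
qed

lemma laplacian_ucol_power: "laplacian p (ucol \<sigma> One ^ i * ucol \<sigma> Two ^ j) = 0"
  using row_ratio_ucol_power laplacian_row_ratio by blast

lemma euler_row_ratio:
  assumes "row_ratio \<sigma> f"
  shows "euler f = (\<Sum>k\<in>UNIV. D Two k f * ucol \<sigma> k)"
proof -
  have "D One k f * xgen One k = D Two k f * qscale \<sigma> (xgen One k)" for k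
    using assms by (metis row_ratio_def scalar_left_commute mult.assoc)
  then show ?thesis
    by (simp add: euler_def ucol_def sum_ix distrib_left add_ac)
qed

text \<open>The column counterpart of \<open>Rmat_eigenvector\<close>; it holds because the two
  columns commute.\<close>

lemma Rmat_ucol:
  "(\<Sum>a\<in>UNIV. \<Sum>b\<in>UNIV. qscale (Rmat p (b, a) (l, k)) (ucol \<sigma> a * ucol \<sigma> b))
    = qscale (inverse p) (ucol \<sigma> l * ucol \<sigma> k)"
  by (cases l; cases k; simp add: sum_ix ucol_commute[of _ Two One] scalar_diff algebra_simps)

text \<open>The row R-matrix and the column R-matrix each contribute one factor p^-1.\<close>

lemma euler_mult_ucol:
  assumes "row_ratio \<sigma> f"
  shows "euler (f * ucol \<sigma> k) = qscale (inverse (p^2)) (euler f * ucol \<sigma> k) + f * ucol \<sigma> k"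
proof -
  have "euler (f * ucol \<sigma> k) = qscale (inverse p)
      (\<Sum>l\<in>UNIV. D Two l f * (\<Sum>a\<in>UNIV. \<Sum>b\<in>UNIV. qscale (Rmat p (b, a) (l, k)) (ucol \<sigma> a * ucol \<sigma> b)))
     + f * ucol \<sigma> k"
    unfolding euler_row_ratio[OF row_ratio_mult_ucol[OF assms]] D_mult_ucol[OF assms]
    by (cases k) (simp_all add: sum_ix distrib_left distrib_right mult.assoc
        scalar_left_commute[of "D _ _ _"] add_ac del: Rmat.simps)
  also have "\<dots> = qscale (inverse (p^2)) (euler f * ucol \<sigma> k) + f * ucol \<sigma> k"
    unfolding Rmat_ucol euler_row_ratio[OF assms]
    by (simp add: sum_ix distrib_left distrib_right mult.assoc scalar_left_commute[of "D _ _ _"] power2_eq_square)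
  finally show ?thesis .
qed

text \<open>The q-integer 1 + p^-2 + ... + p^(-2(n-1)), playing the role of the degree as Euler
  eigenvalue.\<close>

primrec qnum :: "nat \<Rightarrow> cq" where
  "qnum 0 = 0"
| "qnum (Suc n) = inverse (p^2) * qnum n + 1"

lemma euler_ucol_power:
  "euler (ucol \<sigma> One ^ i * ucol \<sigma> Two ^ j) = qscale (qnum (i + j)) (ucol \<sigma> One ^ i * ucol \<sigma> Two ^ j)"
proof (induction i j rule: Xcoeff_induct)
  case zero
  show ?case by (simp add: euler_def D_one)
next
  case (left i)
  then show ?case
    using euler_mult_ucol[OF row_ratio_ucol_power[THEN conjunct1], of \<sigma> i 0 One]
    by (simp add: power_Suc2 scalar_add algebra_simps del: power_Suc)
next
  case (right i j)
  then show ?case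
    using euler_mult_ucol[OF row_ratio_ucol_power[THEN conjunct1], of \<sigma> i j Two]
    by (simp add: power_Suc2 scalar_add algebra_simps del: power_Suc)
qed

lemma laplacian_add: "laplacian p (f + g) = laplacian p f + laplacian p g"
  and laplacian_scale: "laplacian p (qscale c f) = qscale c (laplacian p f)"
  and euler_add: "euler (f + g) = euler f + euler g"
  and euler_scale: "euler (qscale c f) = qscale c (euler f)"
  by (simp_all add: laplacian_def euler_def D_add D_scale sum.distrib sum_distrib_left algebra_simps)

text \<open>Neither \<open>T\<close> nor \<open>c\<close> depends on \<sigma>, so
  \<open>vandermonde_zero\<close> applies to the differences
  \<open>T (Xcoeff i j t) - qscale c (Xcoeff i j t)\<close>.\<close>

lemma linear_coefficients:
  assumes add: "\<And>f g. T (f + g) = T f + T g" and scale: "\<And>c f. T (qscale c f) = qscale c (T f)"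
    and T: "\<And>\<sigma>. T (ucol \<sigma> One ^ i * ucol \<sigma> Two ^ j) = qscale c (ucol \<sigma> One ^ i * ucol \<sigma> Two ^ j)"
  shows "T (Xcoeff i j t) = qscale c (Xcoeff i j t)"
proof (cases "t \<le> i + j")
  case True
  have T0: "T 0 = 0" using scale[of 0 0] by simp
  have sum: "T (sum h A) = (\<Sum>x\<in>A. T (h x))" for h and A :: "nat set"
    by (induction A rule: infinite_finite_induct) (simp_all add: T0 add)
  have "(\<Sum>t\<le>i + j. qscale (\<sigma> ^ t) (T (Xcoeff i j t) - qscale c (Xcoeff i j t))) = 0" for \<sigma>
    using T[of \<sigma>] unfolding sum_Xcoeff[symmetric] sum scale sum_distrib_left
    by (simp add: right_diff_distrib sum_subtractf mult.commute)
  from vandermonde_zero[OF this True] show ?thesis by simp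
next
  case False
  then show ?thesis using scale[of 0 0] by (simp add: Xcoeff_eq_0)
qed

lemma laplacian_Xcoeff: "laplacian p (Xcoeff i j t) = 0"
proof -
  have "laplacian p (Xcoeff i j t) = qscale 0 (Xcoeff i j t)"
    by (rule linear_coefficients)
       (simp_all add: laplacian_add laplacian_scale laplacian_ucol_power)
  then show ?thesis by simp
qed

lemma euler_Xcoeff: "euler (Xcoeff i j t) = qscale (qnum (i + j)) (Xcoeff i j t)"
  by (rule linear_coefficients) (simp_all only: euler_add euler_scale euler_ucol_power)

end

section \<open>Nonvanishing of the eigenvalues\<close>

text \<open>Only used to see that sums of products of powers of \<open>q\<close> do not vanish.\<close>

definition positive :: "cq \<Rightarrow> bool" where
  "positive c \<longleftrightarrow> (\<exists>f g r s. c = Fract f g \<and> poly f 1 = complex_of_real r \<and> r > 0 \<and>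
     poly g 1 = complex_of_real s \<and> s > 0)"

lemma positive_nonzero: "positive c \<Longrightarrow> c \<noteq> 0"
  by (auto simp: positive_def Zero_fract_def eq_fract) (metis less_irrefl of_real_eq_0_iff poly_0 mult_zero_left eq_fract(2) eq_fract(1) zero_neq_one mult.right_neutral)

lemma positive_add: "positive c \<Longrightarrow> positive d \<Longrightarrow> positive (c + d)"
proof -
  assume "positive c" "positive d"
  then obtain f g r s f' g' r' s' where
    "c = Fract f g" "poly f 1 = complex_of_real r" "r > 0" "poly g 1 = complex_of_real s" "s > 0"
    "d = Fract f' g'" "poly f' 1 = complex_of_real r'" "r' > 0" "poly g' 1 = complex_of_real s'" "s' > 0"
    unfolding positive_def by blast
  moreover from this have "g \<noteq> 0" "g' \<noteq> 0" by auto
  ultimately have "c + d = Fract (f * g' + f' * g) (g * g')"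
    "poly (f * g' + f' * g) 1 = complex_of_real (r * s' + r' * s)" "r * s' + r' * s > 0"
    "poly (g * g') 1 = complex_of_real (s * s')" "s * s' > 0"
    by (simp_all add: add_pos_pos)
  then show ?thesis unfolding positive_def by blast
qed

lemma positive_mult: "positive c \<Longrightarrow> positive d \<Longrightarrow> positive (c * d)"
proof -
  assume "positive c" "positive d"
  then obtain f g r s f' g' r' s' where
    "c = Fract f g" "poly f 1 = complex_of_real r" "r > 0" "poly g 1 = complex_of_real s" "s > 0"
    "d = Fract f' g'" "poly f' 1 = complex_of_real r'" "r' > 0" "poly g' 1 = complex_of_real s'" "s' > 0"
    unfolding positive_def by blast
  then have "c * d = Fract (f * f') (g * g')"
    "poly (f * f') 1 = complex_of_real (r * r')" "r * r' > 0"
    "poly (g * g') 1 = complex_of_real (s * s')" "s * s' > 0"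
    by simp_all
  then show ?thesis unfolding positive_def by blast
qed

lemma positive_inverse: "positive c \<Longrightarrow> positive (inverse c)"
  unfolding positive_def by (metis inverse_fract)

lemma positive_one: "positive 1"
  unfolding positive_def One_fract_def by (metis poly_1 of_real_1 zero_less_one)

lemma positive_qpar: "positive qpar"
  unfolding positive_def qpar_def
  by (intro exI[of _ "[:0, 1:]"] exI[of _ 1]) simp

lemma positive_power: "positive c \<Longrightarrow> positive (c ^ n)"
  by (induction n) (simp_all add: positive_one positive_mult)

lemmas positive_intros = positive_add positive_mult positive_inverse positive_one positive_qpar
  positive_power

lemma positive_affine:
  "positive a \<Longrightarrow> positive b \<Longrightarrow> positive c \<or> c = 0 \<Longrightarrow> positive (a * c + b)"
  by (auto intro: positive_intros)

context quantum_calculus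
begin

lemma positive_p: "positive p" "positive (inverse (p ^ n))" "positive (1 + p^2)"
proof -
  show "positive p" using p by (auto intro: positive_intros)
  then show "positive (inverse (p ^ n))" "positive (1 + p^2)" by (intro positive_intros; assumption)+
qed

lemma positive_qnum: "positive (qnum n) \<or> qnum n = 0"
  by (induction n) (simp_all add: positive_affine positive_one positive_p)

primrec euler_num :: "nat \<Rightarrow> nat \<Rightarrow> cq" where
  "euler_num n 0 = qnum n"
| "euler_num n (Suc k) = inverse (p^2) * euler_num n k + (1 + p^2)"

text \<open>The recursion is read off from \<open>laplacian_detq\<close>; it starts at 0 because the
  \<open>Xcoeff\<close> are harmonic.\<close>

primrec laplace_num :: "nat \<Rightarrow> nat \<Rightarrow> cq" where
  "laplace_num n 0 = 0"
| "laplace_num n (Suc k) = inverse (p^4) * laplace_num n k + (1 + p^2) + inverse (p^2) * euler_num n k"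

lemma positive_euler_num: "positive (euler_num n k) \<or> euler_num n k = 0"
  by (induction k) (simp_all add: positive_affine positive_p positive_qnum)

text \<open>The summand 1 + p^2 keeps the value at q = 1 positive, even where the other summands
  vanish.\<close>

lemma positive_laplace_num: "positive (laplace_num n (Suc k))"
proof -
  have step: "positive (laplace_num n (Suc k))" if "positive (laplace_num n k) \<or> laplace_num n k = 0" for k
  proof -
    have "positive (inverse (p^2) * euler_num n k + (inverse (p^4) * laplace_num n k + (1 + p^2)))"
      by (intro positive_affine that positive_euler_num positive_p)
    then show ?thesis by (simp add: add_ac)
  qed
  have "positive (laplace_num n k) \<or> laplace_num n k = 0" for k
    by (induction k) (use step in \<open>simp_all del: laplace_num.simps(2)\<close>)
  then show ?thesis by (rule step)
qed

lemma euler_Xcoeff_detq: "euler (Xcoeff i j t * detq ^ k) = qscale (euler_num (i + j) k) (Xcoeff i j t * detq ^ k)"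
proof (induction k)
  case 0
  show ?case by (simp add: euler_Xcoeff)
next
  case (Suc k)
  then show ?case
    using euler_detq[of "Xcoeff i j t * detq ^ k"]
    by (simp add: power_Suc2 scalar_add algebra_simps del: power_Suc)
qed

lemma laplacian_Xcoeff_detq:
  "laplacian p (Xcoeff i j t * detq ^ k) =
    (case k of 0 \<Rightarrow> 0 | Suc k' \<Rightarrow> qscale (laplace_num (i + j) k) (Xcoeff i j t * detq ^ k'))"
proof (induction k)
  case 0
  show ?case by (simp add: laplacian_Xcoeff)
next
  case (Suc k)
  \<comment> \<open>A form without case distinction: the extra \<open>detq\<close> restores the lost
    power, and for \<open>k = 0\<close> both sides vanish.\<close>
  have "laplacian p (Xcoeff i j t * detq ^ k) * detq = qscale (laplace_num (i + j) k) (Xcoeff i j t * detq ^ k)"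
    unfolding Suc.IH by (cases k) (simp_all add: power_Suc2 mult.assoc del: power_Suc)
  then show ?case
    using laplacian_detq[of "Xcoeff i j t * detq ^ k"]
    by (simp add: power_Suc2 scalar_add euler_Xcoeff_detq algebra_simps del: power_Suc)
qed

end

section \<open>Reduction modulo the quantum determinant\<close>

text \<open>Modulo the quantum determinant, \<open>x\<^sub>r\<^sub>c\<close> becomes \<open>y\<^sub>r z\<^sub>c\<close> with \<open>y\<^sub>2 y\<^sub>1 = q\<^sup>2 y\<^sub>1 y\<^sub>2\<close> and
  commuting \<open>z\<^sub>1, z\<^sub>2\<close>.  An element of \<open>segre\<close> lists the coefficients at the
  monomials \<open>y\<^sub>1\<^sup>t y\<^sub>2\<^sup>r z\<^sub>1\<^sup>i z\<^sub>2\<^sup>j\<close>, and \<open>segre_gen\<close> is right multiplication by a generator.\<close>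

type_synonym segre = "nat \<Rightarrow> nat \<Rightarrow> nat \<Rightarrow> nat \<Rightarrow> cq"

text \<open>The power of q arises when a new y_1 on the right is moved left past y_2^r.\<close>

fun segre_row :: "ix \<Rightarrow> segre \<Rightarrow> segre" where
  "segre_row One F t r = (case t of 0 \<Rightarrow> (\<lambda>i j. 0) | Suc t' \<Rightarrow> (\<lambda>i j. qpar ^ (2 * r) * F t' r i j))"
| "segre_row Two F t r = (case r of 0 \<Rightarrow> (\<lambda>i j. 0) | Suc r' \<Rightarrow> F t r')"

fun segre_col :: "ix \<Rightarrow> segre \<Rightarrow> segre" where
  "segre_col One F t r i j = (case i of 0 \<Rightarrow> 0 | Suc i' \<Rightarrow> F t r i' j)"
| "segre_col Two F t r i j = (case j of 0 \<Rightarrow> 0 | Suc j' \<Rightarrow> F t r i j')"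

definition segre_gen :: "gen \<Rightarrow> segre \<Rightarrow> segre" where
  "segre_gen g F = segre_row (fst g) (segre_col (snd g) F)"

fun segre_word :: "word \<Rightarrow> segre \<Rightarrow> segre" where
  "segre_word (Word w) F = fold segre_gen w F"

definition segre_free :: "free \<Rightarrow> segre \<Rightarrow> segre" where
  "segre_free f F t r i j = (\<Sum>w\<in>Poly_Mapping.keys f. Poly_Mapping.lookup f w * segre_word w F t r i j)"

lemma segre_gen_linear:
  "segre_gen g (\<lambda>t r i j. a * F t r i j + b * G t r i j) =
    (\<lambda>t r i j. a * segre_gen g F t r i j + b * segre_gen g G t r i j)"
proof (intro ext)
  fix t r i j
  show "segre_gen g (\<lambda>t r i j. a * F t r i j + b * G t r i j) t r i j =
     a * segre_gen g F t r i j + b * segre_gen g G t r i j"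
    by (cases "fst g"; cases "snd g"; simp add: segre_gen_def algebra_simps split: nat.split)
qed

lemma segre_fold_linear:
  "fold segre_gen w (\<lambda>t r i j. a * F t r i j + b * G t r i j) =
    (\<lambda>t r i j. a * fold segre_gen w F t r i j + b * fold segre_gen w G t r i j)"
  by (induction w arbitrary: F G) (simp_all add: segre_gen_linear)

lemma segre_free_superset:
  assumes "finite A" "Poly_Mapping.keys f \<subseteq> A"
  shows "segre_free f F t r i j = (\<Sum>w\<in>A. Poly_Mapping.lookup f w * segre_word w F t r i j)"
  unfolding segre_free_def using assms
  by (intro sum.mono_neutral_left) (auto simp: in_keys_iff)

lemma segre_free_add: "segre_free (f + g) F t r i j = segre_free f F t r i j + segre_free g F t r i j"
proof -
  let ?A = "Poly_Mapping.keys f \<union> Poly_Mapping.keys g"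
  show ?thesis
    using keys_add[of f g]
    by (simp add: segre_free_superset[of ?A] lookup_add distrib_right sum.distrib)
qed

lemma segre_free_single: "segre_free (Poly_Mapping.single w c) F t r i j = c * segre_word w F t r i j"
  by (subst segre_free_superset[of "{w}"]) auto

lemma segre_free_linear:
  "segre_free f (\<lambda>t r i j. a * F t r i j + b * G t r i j) t r i j =
    a * segre_free f F t r i j + b * segre_free f G t r i j"
proof (induction f rule: free_induct)
  case (1 w c)
  then show ?case by (cases w) (simp add: segre_free_single segre_fold_linear algebra_simps)
qed (simp add: segre_free_add algebra_simps)

lemma segre_free_zero_vec: "segre_free f (\<lambda>t r i j. 0) t r i j = 0"
  using segre_free_linear[of f 0 _ 0] by simp

lemma segre_free_mult: "segre_free (f * g) F t r i j = segre_free g (segre_free f F) t r i j"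
proof (induction f rule: free_induct)
  case (1 u c)
  \<comment> \<open>The summand with factor 0 only produces the shape required by
    \<open>segre_free_linear\<close>.\<close>
  have *: "segre_free (Poly_Mapping.single u c) F = (\<lambda>t r i j. c * segre_word u F t r i j + 0 * segre_word u F t r i j)"
    by (intro ext) (simp add: segre_free_single)
  show ?case
    unfolding * segre_free_linear
  proof (induction g rule: free_induct)
    case (1 v d)
    show ?case by (cases u; cases v) (simp add: mult_single segre_free_single)
  qed (simp add: segre_free_add algebra_simps)
next
  case (2 f f')
  have *: "segre_free (f + f') F = (\<lambda>t r i j. 1 * segre_free f F t r i j + 1 * segre_free f' F t r i j)"
    by (intro ext) (simp add: segre_free_add)
  show ?case unfolding * segre_free_linear using 2 by (simp add: distrib_right segre_free_add)
qed

lemma segre_free_diff: "segre_free (f - g) F t r i j = segre_free f F t r i j - segre_free g F t r i j"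
  using segre_free_add[of "f - g" g F t r i j] by simp

lemma segre_free_X: "segre_free (X_free a b) F = segre_gen (a, b) F"
  by (intro ext) (simp add: X_free_def segre_free_single)

lemma segre_free_const: "segre_free (const_free c) F = (\<lambda>t r i j. c * F t r i j)"
  by (intro ext) (simp add: const_free_def segre_free_single zero_word_def)

lemma segre_free_relator: "\<forall>f\<in>relators. segre_free f F t r i j = 0"
  unfolding relators_def Let_def ball_simps
  by (simp add: segre_free_diff segre_free_add segre_free_mult segre_free_X
    segre_free_const segre_gen_def power2_eq_square field_simps split: nat.split)

lemma segre_free_rel_ideal: "f \<in> rel_ideal \<Longrightarrow> segre_free f F t r i j = 0"
proof (induction arbitrary: F t r i j rule: rel_ideal.induct)
  case zero
  show ?case by (simp add: segre_free_def)
next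
  case (mult_right f h)
  then have "segre_free f F = (\<lambda>t r i j. 0)" for F by (intro ext)
  then show ?case by (simp add: segre_free_mult segre_free_zero_vec)
qed (simp_all add: segre_free_relator segre_free_add segre_free_mult)

lift_definition segre_act :: "qmat \<Rightarrow> segre \<Rightarrow> segre" is segre_free
  by (intro ext) (metis segre_free_diff segre_free_rel_ideal right_minus_eq)

lemma segre_act_add: "segre_act (f + g) F t r i j = segre_act f F t r i j + segre_act g F t r i j"
  by transfer (rule segre_free_add)

lemma segre_act_diff: "segre_act (f - g) F t r i j = segre_act f F t r i j - segre_act g F t r i j"
  by transfer (rule segre_free_diff)

lemma segre_act_mult: "segre_act (f * g) F = segre_act g (segre_act f F)"
  by transfer (intro ext segre_free_mult)

lemma segre_act_scalar: "segre_act (scalar c) F = (\<lambda>t r i j. c * F t r i j)"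
  by transfer (rule segre_free_const)

lemma segre_act_xgen: "segre_act (xgen a b) F = segre_gen (a, b) F"
  by transfer (rule segre_free_X)

lemma segre_act_linear:
  "segre_act f (\<lambda>t r i j. a * F t r i j + b * G t r i j) t r i j =
    a * segre_act f F t r i j + b * segre_act f G t r i j"
  by transfer (rule segre_free_linear)

text \<open>In the model y_1 z_1 y_2 z_2 = y_1 z_2 y_2 z_1, so the two terms of the determinant
  cancel.\<close>

lemma segre_act_detq: "segre_act detq F t r i j = 0"
  by (simp add: detq_def segre_act_diff segre_act_mult segre_act_xgen segre_gen_def split: nat.split)

definition segre_one :: segre where
  "segre_one t r i j = (if t = 0 \<and> r = 0 \<and> i = 0 \<and> j = 0 then 1 else 0)"

definition segre_coeff :: "nat \<Rightarrow> nat \<Rightarrow> nat \<Rightarrow> nat \<Rightarrow> qmat \<Rightarrow> cq" where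
  "segre_coeff t r i j f = segre_act f segre_one t r i j"

lemma segre_coeff_add: "segre_coeff t r i j (f + g) = segre_coeff t r i j f + segre_coeff t r i j g"
  by (simp add: segre_coeff_def segre_act_add)

lemma segre_coeff_scale: "segre_coeff t r i j (qscale c f) = c * segre_coeff t r i j f"
  using segre_act_linear[of f c segre_one 0 segre_one]
  by (simp add: segre_coeff_def segre_act_mult segre_act_scalar)

lemma segre_coeff_zero: "segre_coeff t r i j 0 = 0"
  using segre_coeff_scale[of t r i j 0 0] by simp

lemma segre_coeff_mult_detq: "segre_coeff t r i j (f * detq) = 0"
  by (simp add: segre_coeff_def segre_act_mult segre_act_detq)

lemma segre_coeff_mult_xgen:
  "segre_coeff t r i j (f * xgen a b) = segre_gen (a, b) (\<lambda>t r i j. segre_coeff t r i j f) t r i j"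
  by (simp add: segre_coeff_def[abs_def] segre_act_mult segre_act_xgen)

text \<open>The Gaussian binomial "t + r choose t" in base q^2, given by its Pascal rule.\<close>

fun qbinom :: "nat \<Rightarrow> nat \<Rightarrow> cq" where
  "qbinom 0 r = 1"
| "qbinom (Suc t) 0 = 1"
| "qbinom (Suc t) (Suc r) = qpar ^ (2 * Suc r) * qbinom t (Suc r) + qbinom (Suc t) r"

lemma positive_qbinom: "positive (qbinom t r)"
  by (induction t r rule: qbinom.induct) (auto simp del: mult_Suc_right power_Suc intro!: positive_intros)

lemma qbinom_0_right: "qbinom t 0 = 1"
  by (cases t) simp_all

text \<open>In the model the generating function is (y_1 s + y_2)^(i+j) z_1^i z_2^j, so each
  \<open>Xcoeff\<close> is a q-binomial multiple of a single monomial.\<close>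

lemma segre_coeff_Xcoeff:
  "segre_coeff t r i j (Xcoeff i' j' t') =
    (if i' = i \<and> j' = j \<and> t' = t \<and> t + r = i + j then qbinom t r else 0)"
proof (induction i' j' arbitrary: t r i j t' rule: Xcoeff_induct)
  case zero
  have "segre_coeff t r i j 1 = segre_one t r i j"
    using segre_act_scalar[of 1 segre_one] by (simp add: segre_coeff_def)
  then show ?case by (auto simp: Xcoeff_0 segre_one_def segre_coeff_zero)
next
  case (left i')
  then show ?case
    by (cases t; cases r; cases t'; cases i;
        simp add: qbinom_0_right segre_coeff_zero Xcoeff_Suc_left segre_coeff_add segre_coeff_mult_xgen segre_gen_def)
next
  case (right i' j')
  then show ?case
    by (cases t; cases r; cases t'; cases j;
        simp add: qbinom_0_right segre_coeff_zero Xcoeff_Suc_right segre_coeff_add segre_coeff_mult_xgen segre_gen_def)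
qed

section \<open>Powers of the determinant times the \<open>X\<^sup>l\<^sub>m\<^sub>n\<close> span\<close>

lemma mono_qmat_append: "mono_qmat (u @ v) = mono_qmat u * mono_qmat v"
  by (induction u) (simp_all add: mono_qmat_Cons mono_qmat_Nil mult.assoc)

lemma mono_qmat_single: "mono_qmat [g] = xgen (fst g) (snd g)"
  by (simp add: mono_qmat_Cons mono_qmat_Nil)

text \<open>The homogeneous part of degree \<open>n\<close> of the ideal of \<open>detq\<close>.
  Recording the degree lets \<open>mono_qmat_span\<close> use induction on word length.\<close>

definition det_part :: "nat \<Rightarrow> qmat set" where
  "det_part n = qmat.span {mono_qmat v * detq | v. length v + 2 = n}"

lemmas det_part_closed =
  qmat.span_add[where S = "{mono_qmat v * detq | v. length v + 2 = n}" for n, folded det_part_def]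
  qmat.span_diff[where S = "{mono_qmat v * detq | v. length v + 2 = n}" for n, folded det_part_def]
  qmat.span_scale[where S = "{mono_qmat v * detq | v. length v + 2 = n}" for n, folded det_part_def]
  qmat.span_zero[where S = "{mono_qmat v * detq | v. length v + 2 = n}" for n, folded det_part_def]

lemma det_part_base: "length v + 2 = n \<Longrightarrow> mono_qmat v * detq \<in> det_part n"
  unfolding det_part_def by (intro qmat.span_base) blast

lemma detq_mult_xgen: "\<exists>k. detq * xgen r s = qscale k (xgen r s * detq)"
proof -
  have "detq * xgen One One = qscale 1 (xgen One One * detq)"
    "detq * xgen Two Two = qscale 1 (xgen Two Two * detq)"
    "detq * xgen One Two = qscale (qpar^2) (xgen One Two * detq)"
    "detq * xgen Two One = qscale (inverse (qpar^2)) (xgen Two One * detq)"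
    by (simp_all add: detq_def xgen_normal xgen_normal_left scalar_power2 scalar_move
        scalar_qpar_inverse algebra_simps del: qmat.scale_scale)
  then show ?thesis by (cases r; cases s) blast+
qed

lemma detq_mult_mono: "\<exists>k. detq * mono_qmat w = qscale k (mono_qmat w * detq)"
proof (induction w)
  case Nil
  show ?case by (rule exI[of _ 1]) (simp add: mono_qmat_Nil)
next
  case (Cons g w)
  obtain k l where "detq * mono_qmat w = qscale k (mono_qmat w * detq)"
    "detq * xgen (fst g) (snd g) = qscale l (xgen (fst g) (snd g) * detq)"
    using Cons detq_mult_xgen by blast
  then have "detq * mono_qmat (g # w) = qscale (l * k) (mono_qmat (g # w) * detq)"
    unfolding mono_qmat_Cons mult.assoc[symmetric] by (simp add: mult.assoc scalar_move)
  then show ?case by blast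
qed

lemma det_part_mult_left: "f \<in> det_part n \<Longrightarrow> xgen r s * f \<in> det_part (Suc n)"
  unfolding det_part_def[of n]
proof (induction f rule: qmat.span_induct_alt)
  case base
  show ?case by (simp add: det_part_closed)
next
  case (step c x y)
  then obtain v where "x = mono_qmat v * detq" "length v + 2 = n" by blast
  then have "xgen r s * x \<in> det_part (Suc n)"
    using det_part_base[of "(r, s) # v"] by (simp add: mono_qmat_Cons mult.assoc)
  then show ?case using step.IH by (simp add: distrib_left scalar_move det_part_closed)
qed

lemma det_part_mult_right: "f \<in> det_part n \<Longrightarrow> f * xgen r s \<in> det_part (Suc n)"
  unfolding det_part_def[of n]
proof (induction f rule: qmat.span_induct_alt)
  case base
  show ?case by (simp add: det_part_closed)
next
  case (step c x y)
  then obtain v where v: "x = mono_qmat v * detq" "length v + 2 = n" by blast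
  obtain k where "detq * xgen r s = qscale k (xgen r s * detq)" using detq_mult_xgen by blast
  then have "x * xgen r s = qscale k (mono_qmat (v @ [(r, s)]) * detq)"
    by (simp add: v mono_qmat_append mono_qmat_single mult.assoc scalar_left_commute[of "mono_qmat v"])
  then have "x * xgen r s \<in> det_part (Suc n)"
    using det_part_base[of "v @ [(r, s)]"] v by (simp add: det_part_closed)
  then show ?case using step.IH by (simp add: distrib_right mult.assoc det_part_closed)
qed

lemma segre_coeff_det_part: "f \<in> det_part n \<Longrightarrow> segre_coeff t r i j f = 0"
  unfolding det_part_def
  by (induction f rule: qmat.span_induct_alt)
     (auto simp: segre_coeff_zero segre_coeff_add segre_coeff_scale segre_coeff_mult_detq)

section \<open>Words up to scalars, modulo the determinant\<close>

text \<open>The scalar is left unspecified, and may be 0, to avoid tracking powers of q; where it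
  must be nonzero, \<open>segre_coeff\<close> shows this afterwards.\<close>

definition word_cong :: "qmat \<Rightarrow> gen list \<Rightarrow> bool" where
  "word_cong f w \<longleftrightarrow> (\<exists>k. f - qscale k (mono_qmat w) \<in> det_part (length w))"

definition word_eqv :: "gen list \<Rightarrow> gen list \<Rightarrow> bool" where
  "word_eqv u v \<longleftrightarrow> mset (map fst u) = mset (map fst v) \<and> mset (map snd u) = mset (map snd v) \<and>
     word_cong (mono_qmat u) v"

lemma word_eqv_length: "word_eqv u v \<Longrightarrow> length u = length v"
  unfolding word_eqv_def by (metis length_map mset_eq_length)

lemma word_cong_refl: "word_cong (mono_qmat w) w"
  unfolding word_cong_def by (rule exI[of _ 1]) (simp add: det_part_closed)

lemma word_cong_trans: "word_cong f u \<Longrightarrow> word_eqv u v \<Longrightarrow> word_cong f v"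
proof -
  assume "word_cong f u" "word_eqv u v"
  then obtain k l where
    "f - qscale k (mono_qmat u) \<in> det_part (length v)"
    "mono_qmat u - qscale l (mono_qmat v) \<in> det_part (length v)"
    using word_eqv_length[of u v] by (auto simp: word_cong_def word_eqv_def)
  then have "(f - qscale k (mono_qmat u)) + qscale k (mono_qmat u - qscale l (mono_qmat v)) \<in> det_part (length v)"
    by (rule det_part_closed(1)[OF _ det_part_closed(3)])
  then have "f - qscale (k * l) (mono_qmat v) \<in> det_part (length v)"
    by (simp add: algebra_simps)
  then show ?thesis unfolding word_cong_def by blast
qed

lemma word_cong_add: "word_cong f w \<Longrightarrow> word_cong g w \<Longrightarrow> word_cong (f + g) w"
proof -
  assume "word_cong f w" "word_cong g w"
  then obtain k l where
    "f - qscale k (mono_qmat w) \<in> det_part (length w)"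
    "g - qscale l (mono_qmat w) \<in> det_part (length w)"
    unfolding word_cong_def by blast
  from det_part_closed(1)[OF this]
  have "(f + g) - qscale (k + l) (mono_qmat w) \<in> det_part (length w)"
    by (simp add: algebra_simps scalar_add)
  then show ?thesis unfolding word_cong_def by blast
qed

lemma word_cong_mult_xgen: "word_cong f w \<Longrightarrow> word_cong (f * xgen r s) (w @ [(r, s)])"
proof -
  assume "word_cong f w"
  then obtain k where "f - qscale k (mono_qmat w) \<in> det_part (length w)"
    unfolding word_cong_def by blast
  from det_part_mult_right[OF this, of r s]
  have "f * xgen r s - qscale k (mono_qmat (w @ [(r, s)])) \<in> det_part (length (w @ [(r, s)]))"
    by (simp add: left_diff_distrib mono_qmat_append mono_qmat_single mult.assoc)
  then show ?thesis unfolding word_cong_def by blast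
qed

lemma word_eqv_refl: "word_eqv w w"
  by (simp add: word_eqv_def word_cong_refl)

lemma word_eqv_trans: "word_eqv u v \<Longrightarrow> word_eqv v w \<Longrightarrow> word_eqv u w"
  by (auto simp: word_eqv_def[of u] word_eqv_def[of v w] intro: word_cong_trans)

lemma word_eqv_Cons: "word_eqv u v \<Longrightarrow> word_eqv (g # u) (g # v)"
proof -
  assume "word_eqv u v"
  then obtain k where k: "mono_qmat u - qscale k (mono_qmat v) \<in> det_part (length v)"
    and m: "mset (map fst u) = mset (map fst v)" "mset (map snd u) = mset (map snd v)"
    by (auto simp: word_eqv_def word_cong_def)
  from det_part_mult_left[OF k, of "fst g" "snd g"]
  have "mono_qmat (g # u) - qscale k (mono_qmat (g # v)) \<in> det_part (length (g # v))"
    by (simp add: mono_qmat_Cons right_diff_distrib scalar_move)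
  then show ?thesis using m by (auto simp: word_eqv_def word_cong_def)
qed

text \<open>Lifts a two-letter identity to words: the \<open>detq\<close> term is carried past the
  remaining letters by \<open>detq_mult_mono\<close> and lands in \<open>det_part\<close>.\<close>

lemma word_eqv_swap:
  assumes "xgen r c * xgen r' c' = qscale k (xgen s d * xgen s' d') + qscale l detq"
    "{#r, r'#} = {#s, s'#}" "{#c, c'#} = {#d, d'#}"
  shows "word_eqv ((r, c) # (r', c') # w) ((s, d) # (s', d') # w)"
proof -
  obtain m where m: "detq * mono_qmat w = qscale m (mono_qmat w * detq)"
    using detq_mult_mono by blast
  have "mono_qmat ((r, c) # (r', c') # w) = qscale k (mono_qmat ((s, d) # (s', d') # w))
      + qscale (l * m) (mono_qmat w * detq)"
    using arg_cong[OF assms(1), of "\<lambda>f. f * mono_qmat w"] m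
    by (simp add: mono_qmat_Cons mult.assoc distrib_right)
  then have "mono_qmat ((r, c) # (r', c') # w) - qscale k (mono_qmat ((s, d) # (s', d') # w))
      \<in> det_part (length ((s, d) # (s', d') # w))"
    using det_part_base[of w] by (simp add: det_part_closed)
  moreover have "mset (map fst ((r, c) # (r', c') # w)) = mset (map fst ((s, d) # (s', d') # w))"
    "mset (map snd ((r, c) # (r', c') # w)) = mset (map snd ((s, d) # (s', d') # w))"
    using arg_cong[OF assms(2), of "\<lambda>A. A + mset (map fst w)"]
      arg_cong[OF assms(3), of "\<lambda>A. A + mset (map snd w)"] by simp_all
  ultimately show ?thesis unfolding word_eqv_def word_cong_def by blast
qed

lemma detq_normal:
  "xgen One One * xgen Two Two = xgen One Two * xgen Two One + detq"
  "xgen Two Two * xgen One One = scalar qpar * (scalar qpar * (xgen One Two * xgen Two One)) + detq"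
  "xgen Two One * xgen One Two = scalar qpar * (scalar qpar * (xgen One Two * xgen Two One))"
  by (simp_all add: detq_def xgen_normal algebra_simps)

text \<open>With x_rc = y_r z_c this interchanges two y, which costs q^2 or q^-2 when the rows
  differ.\<close>

lemma swap_rows: "word_eqv ((r, c) # (r', c') # w) ((r', c) # (r, c') # w)"
proof -
  have "xgen One One * xgen Two One = qscale (inverse (qpar^2)) (xgen Two One * xgen One One) + qscale 0 detq"
    "xgen One One * xgen Two Two = qscale (inverse (qpar^2)) (xgen Two One * xgen One Two) + qscale 1 detq"
    "xgen One Two * xgen Two One = qscale (inverse (qpar^2)) (xgen Two Two * xgen One One)
       + qscale (- inverse (qpar^2)) detq"
    "xgen One Two * xgen Two Two = qscale (inverse (qpar^2)) (xgen Two Two * xgen One Two) + qscale 0 detq"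
    "xgen Two One * xgen One One = qscale (qpar^2) (xgen One One * xgen Two One) + qscale 0 detq"
    "xgen Two One * xgen One Two = qscale (qpar^2) (xgen One One * xgen Two Two) + qscale (- (qpar^2)) detq"
    "xgen Two Two * xgen One One = qscale (qpar^2) (xgen One Two * xgen Two One) + qscale 1 detq"
    "xgen Two Two * xgen One Two = qscale (qpar^2) (xgen One Two * xgen Two Two) + qscale 0 detq"
    by (simp_all add: detq_normal xgen_normal(1-4) scalar_power2 scalar_uminus
        scalar_qpar_inverse algebra_simps del: qmat.scale_scale)
  then have "\<exists>k l. xgen r c * xgen r' c' = qscale k (xgen r' c * xgen r c') + qscale l detq"
    if "r \<noteq> r'"
    using that by (cases r; cases r'; cases c; cases c') blast+
  then show ?thesis
    by (cases "r = r'") (auto simp: word_eqv_refl add_mset_commute intro!: word_eqv_swap)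
qed

text \<open>This interchanges two of the commuting z, hence the coefficient 1.\<close>

lemma swap_cols: "word_eqv ((r, c) # (r', c') # w) ((r, c') # (r', c) # w)"
proof -
  have "xgen One One * xgen One Two = qscale 1 (xgen One Two * xgen One One) + qscale 0 detq"
    "xgen One Two * xgen One One = qscale 1 (xgen One One * xgen One Two) + qscale 0 detq"
    "xgen Two One * xgen Two Two = qscale 1 (xgen Two Two * xgen Two One) + qscale 0 detq"
    "xgen Two Two * xgen Two One = qscale 1 (xgen Two One * xgen Two Two) + qscale 0 detq"
    "xgen One One * xgen Two Two = qscale 1 (xgen One Two * xgen Two One) + qscale 1 detq"
    "xgen One Two * xgen Two One = qscale 1 (xgen One One * xgen Two Two) + qscale (- 1) detq"
    "xgen Two One * xgen One Two = qscale 1 (xgen Two Two * xgen One One) + qscale (- 1) detq"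
    "xgen Two Two * xgen One One = qscale 1 (xgen Two One * xgen One Two) + qscale 1 detq"
    by (simp_all add: detq_normal xgen_normal(1-4) scalar_uminus)
  then have "\<exists>k l. xgen r c * xgen r' c' = qscale k (xgen r c' * xgen r' c) + qscale l detq"
    if "c \<noteq> c'"
    using that by (cases r; cases r'; cases c; cases c') blast+
  then show ?thesis
    by (cases "c = c'") (auto simp: word_eqv_refl add_mset_commute intro!: word_eqv_swap)
qed

lemma word_eqv_front_row: "r \<in> fst ` set w \<Longrightarrow> \<exists>c v. word_eqv w ((r, c) # v)"
proof (induction w)
  case (Cons g w)
  obtain r0 c0 where g: "g = (r0, c0)" by (cases g)
  show ?case
  proof (cases "r = r0")
    case True
    then show ?thesis using g word_eqv_refl by blast
  next
    case False
    then obtain c v where "word_eqv w ((r, c) # v)" using Cons g by auto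
    from word_eqv_trans[OF word_eqv_Cons[OF this, of g, unfolded g] swap_rows]
    show ?thesis using g by blast
  qed
qed simp

text \<open>Column swaps leave the rows in place, so a row index already brought to the front stays
  there.\<close>

lemma word_eqv_front_col: "c \<in> snd ` set w \<Longrightarrow> \<exists>v. word_eqv w ((fst (hd w), c) # v)"
proof (induction w)
  case (Cons g w)
  obtain r0 c0 where g: "g = (r0, c0)" by (cases g)
  show ?case
  proof (cases "c = c0")
    case True
    then show ?thesis using g word_eqv_refl by auto
  next
    case False
    then obtain r v where "word_eqv w ((r, c) # v)" using Cons g by auto
    from word_eqv_trans[OF word_eqv_Cons[OF this, of g, unfolded g] swap_cols]
    show ?thesis using g by auto
  qed
qed simp

text \<open>The first letter of \<open>v\<close> is assembled at the front of \<open>u\<close>, its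
  row by \<open>swap_rows\<close> and then its column by \<open>swap_cols\<close>; the induction
  hypothesis handles the rest.\<close>

lemma word_eqvI:
  "mset (map fst u) = mset (map fst v) \<Longrightarrow> mset (map snd u) = mset (map snd v) \<Longrightarrow> word_eqv u v"
proof (induction v arbitrary: u)
  case Nil
  then show ?case by (simp add: word_eqv_refl)
next
  case (Cons g v)
  obtain r c where g: "g = (r, c)" by (cases g)
  have "r \<in> fst ` set u"
    using mset_eq_setD[OF Cons.prems(1)] by (simp add: g)
  then obtain c' u1 where 1: "word_eqv u ((r, c') # u1)" using word_eqv_front_row by blast
  then have "mset (map snd u) = mset (map snd ((r, c') # u1))" by (simp add: word_eqv_def)
  then have "c \<in> snd ` set ((r, c') # u1)"
    using mset_eq_setD[of "map snd ((r, c') # u1)" "map snd (g # v)"] Cons.prems(2)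
    unfolding g set_map by simp
  from word_eqv_front_col[OF this] obtain u2 where "word_eqv ((r, c') # u1) (g # u2)"
    by (auto simp: g)
  with 1 have 2: "word_eqv u (g # u2)" by (rule word_eqv_trans)
  then have "word_eqv u2 v"
    using Cons by (intro Cons.IH) (simp_all add: word_eqv_def)
  from word_eqv_trans[OF 2 word_eqv_Cons[OF this]] show ?case .
qed

definition word_type :: "gen list \<Rightarrow> nat \<Rightarrow> nat \<Rightarrow> nat \<Rightarrow> nat \<Rightarrow> bool" where
  "word_type w t r i j \<longleftrightarrow> mset (map fst w) = replicate_mset t One + replicate_mset r Two \<and>
     mset (map snd w) = replicate_mset i One + replicate_mset j Two"

lemma word_type_length:
  assumes "word_type w t r i j"
  shows "length w = i + j \<and> t + r = i + j"
proof -
  have "size (mset (map fst w)) = t + r" "size (mset (map snd w)) = i + j"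
    using assms by (simp_all add: word_type_def del: mset_map)
  then show ?thesis by simp
qed

lemma word_type_exists: "t + r = i + j \<Longrightarrow> \<exists>w. word_type w t r i j"
  unfolding word_type_def
  by (rule exI[of _ "zip (replicate t One @ replicate r Two) (replicate i One @ replicate j Two)"])
     (simp add: map_fst_zip map_snd_zip)

lemma ix_mset: "A = replicate_mset (count A One) One + replicate_mset (count A Two) Two"
proof (rule multiset_eqI)
  fix x show "count A x = count (replicate_mset (count A One) One + replicate_mset (count A Two) Two) x"
    by (cases x) simp_all
qed

text \<open>All words in the expansion of \<open>Xcoeff i j t\<close> have the row and column
  content of \<open>w\<close>, so \<open>word_eqvI\<close> makes each congruent to a multiple of
  \<open>w\<close>.\<close>

lemma word_cong_Xcoeff: "word_type w t r i j \<Longrightarrow> word_cong (Xcoeff i j t) w"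
proof (induction i j arbitrary: t r w rule: Xcoeff_induct)
  case zero
  then have "w = []" "t = 0" using word_type_length[of w t r 0 0] by auto
  then show ?case using word_cong_refl[of w] by (simp add: Xcoeff_0 mono_qmat_Nil)
next
  case (left i)
  have len: "t + r = Suc i" using word_type_length[OF left.prems] by simp
  have step: "word_cong (Xcoeff i 0 t' * xgen a One) w"
    if "word_type (v @ [(a, One)]) t r (Suc i) 0" "word_type v t' r' i 0" for v t' r' a
    using word_cong_trans[OF left.IH[OF that(2), THEN word_cong_mult_xgen, of a One] word_eqvI]
      that(1) left.prems by (simp only: word_type_def)
  have "word_cong (Xcoeff i 0 t' * xgen One One) w" if "t = Suc t'" for t'
  proof -
    have "t' + r = i + 0" using len that by simp
    from word_type_exists[OF this] obtain v where "word_type v t' r i 0" by blast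
    then show ?thesis by (intro step[of v]) (auto simp: word_type_def that)
  qed
  moreover have "word_cong (Xcoeff i 0 t * xgen Two One) w"
  proof (cases r)
    case 0
    \<comment> \<open>Here t = i + 1 exceeds the degree, and the zero element is congruent to 0
      times any word.\<close>
    then have "Xcoeff i 0 t = 0" using len by (intro Xcoeff_eq_0) simp
    then show ?thesis by (simp add: word_cong_def exI[of _ 0] det_part_closed)
  next
    case (Suc r')
    have "t + r' = i + 0" using len Suc by simp
    from word_type_exists[OF this] obtain v where "word_type v t r' i 0" by blast
    then show ?thesis by (intro step[of v]) (auto simp: word_type_def Suc)
  qed
  ultimately show ?case
    by (cases t) (simp_all add: Xcoeff_Suc_left word_cong_add)
next
  case (right i j)
  have len: "t + r = Suc (i + j)" using word_type_length[OF right.prems] by simp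
  have step: "word_cong (Xcoeff i j t' * xgen a Two) w"
    if "word_type (v @ [(a, Two)]) t r i (Suc j)" "word_type v t' r' i j" for v t' r' a
    using word_cong_trans[OF right.IH[OF that(2), THEN word_cong_mult_xgen, of a Two] word_eqvI]
      that(1) right.prems by (simp only: word_type_def)
  have "word_cong (Xcoeff i j t' * xgen One Two) w" if "t = Suc t'" for t'
  proof -
    have "t' + r = i + j" using len that by simp
    from word_type_exists[OF this] obtain v where "word_type v t' r i j" by blast
    then show ?thesis by (intro step[of v]) (auto simp: word_type_def that)
  qed
  moreover have "word_cong (Xcoeff i j t * xgen Two Two) w"
  proof (cases r)
    case 0
    then have "Xcoeff i j t = 0" using len by (intro Xcoeff_eq_0) simp
    then show ?thesis by (simp add: word_cong_def exI[of _ 0] det_part_closed)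
  next
    case (Suc r')
    have "t + r' = i + j" using len Suc by simp
    from word_type_exists[OF this] obtain v where "word_type v t r' i j" by blast
    then show ?thesis by (intro step[of v]) (auto simp: word_type_def Suc)
  qed
  ultimately show ?case
    by (cases t) (simp_all add: Xcoeff_Suc_right word_cong_add)
qed

definition Xcoeff_det :: "nat \<times> nat \<times> nat \<times> nat \<Rightarrow> qmat" where
  "Xcoeff_det = (\<lambda>(i, j, t, k). Xcoeff i j t * detq ^ k)"

definition Xcoeff_index :: "(nat \<times> nat \<times> nat \<times> nat) set" where
  "Xcoeff_index = {(i, j, t, k). t \<le> i + j}"

lemma span_Xcoeff_det_mult_detq:
  "f \<in> qmat.span (Xcoeff_det ` Xcoeff_index) \<Longrightarrow> f * detq \<in> qmat.span (Xcoeff_det ` Xcoeff_index)"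
proof (induction f rule: qmat.span_induct_alt)
  case base
  show ?case by (simp add: qmat.span_zero)
next
  case (step c x y)
  then obtain i j t k where "x = Xcoeff_det (i, j, t, k)" "(i, j, t, k) \<in> Xcoeff_index" by fast
  then have "x * detq = Xcoeff_det (i, j, t, Suc k)" "(i, j, t, Suc k) \<in> Xcoeff_index"
    by (simp_all add: Xcoeff_det_def Xcoeff_index_def power_Suc2 mult.assoc del: power_Suc)
  then have "x * detq \<in> qmat.span (Xcoeff_det ` Xcoeff_index)" by (simp add: qmat.span_base)
  then show ?case using step.IH by (simp add: distrib_right mult.assoc qmat.span_add qmat.span_scale)
qed

text \<open>A word is a multiple of some \<open>Xcoeff\<close> up to words of length smaller by two
  times \<open>detq\<close>, which the induction hypothesis covers.\<close>

lemma mono_qmat_span: "mono_qmat w \<in> qmat.span (Xcoeff_det ` Xcoeff_index)"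
proof (induction "length w" arbitrary: w rule: less_induct)
  case less
  let ?S = "qmat.span (Xcoeff_det ` Xcoeff_index)"
  have J: "f \<in> ?S" if "f \<in> det_part (length w)" for f
    using that unfolding det_part_def
  proof (induction f rule: qmat.span_induct_alt)
    case (step c x y)
    then obtain v where v: "x = mono_qmat v * detq" "length v + 2 = length w" by blast
    then have "x \<in> ?S" using span_Xcoeff_det_mult_detq[OF less[of v]] by simp
    then show ?case using step.IH by (simp add: qmat.span_add qmat.span_scale)
  qed (rule qmat.span_zero)
  have "word_type w (count (mset (map fst w)) One) (count (mset (map fst w)) Two)
      (count (mset (map snd w)) One) (count (mset (map snd w)) Two)"
    unfolding word_type_def by (intro conjI ix_mset)
  then obtain t r i j where type: "word_type w t r i j" by blast
  then have tr: "t + r = i + j" using word_type_length by blast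
  obtain k where k: "Xcoeff i j t - qscale k (mono_qmat w) \<in> det_part (length w)"
    using word_cong_Xcoeff[OF type] unfolding word_cong_def by blast
  \<comment> \<open>This functional kills the remainder but not \<open>Xcoeff i j t\<close>, so
    \<open>k\<close> is invertible and the congruence can be solved for the word.\<close>
  have "segre_coeff t r i j ((Xcoeff i j t - qscale k (mono_qmat w)) + qscale k (mono_qmat w))
      = k * segre_coeff t r i j (mono_qmat w)"
    by (simp only: segre_coeff_add segre_coeff_scale segre_coeff_det_part[OF k] add_0)
  then have "segre_coeff t r i j (Xcoeff i j t) = k * segre_coeff t r i j (mono_qmat w)" by simp
  moreover have "segre_coeff t r i j (Xcoeff i j t) \<noteq> 0"
    using tr positive_nonzero[OF positive_qbinom] by (simp add: segre_coeff_Xcoeff)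
  ultimately have k0: "k \<noteq> 0" by auto
  have "Xcoeff_det (i, j, t, 0) \<in> Xcoeff_det ` Xcoeff_index"
    using tr by (intro imageI) (simp add: Xcoeff_index_def)
  then have "Xcoeff i j t \<in> ?S" by (simp add: Xcoeff_det_def qmat.span_base)
  then have "Xcoeff i j t - (Xcoeff i j t - qscale k (mono_qmat w)) \<in> ?S"
    using J[OF k] by (rule qmat.span_diff)
  then have "qscale k (mono_qmat w) \<in> ?S" by simp
  from qmat.span_scale[OF this, of "inverse k"] show ?case using k0 by simp
qed

lemma span_Xcoeff_det: "qmat.span (Xcoeff_det ` Xcoeff_index) = UNIV"
proof -
  have "abs_qmat g \<in> qmat.span (Xcoeff_det ` Xcoeff_index)" for g
  proof (induction g rule: free_induct)
    case (1 w c)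
    obtain v where "w = Word v" by (cases w)
    then show ?case
      using qmat.span_scale[OF mono_qmat_span] by (simp only: abs_qmat_single[of v c])
  next
    case (2 f g)
    then show ?case unfolding plus_qmat.abs_eq[symmetric] by (rule qmat.span_add)
  qed
  then have "f \<in> qmat.span (Xcoeff_det ` Xcoeff_index)" for f
    by (cases f rule: qmat_abs_cases) simp
  then show ?thesis by blast
qed

section \<open>The kernel of the quantum Laplacian\<close>

context
  fixes B :: "'i \<Rightarrow> qmat" and \<psi> :: "'i \<Rightarrow> qmat \<Rightarrow> cq" and I :: "'i set"
  assumes \<psi>_add: "\<And>x f g. \<psi> x (f + g) = \<psi> x f + \<psi> x g"
    and \<psi>_scale: "\<And>x c f. \<psi> x (qscale c f) = c * \<psi> x f"
    and \<psi>_same: "\<And>x. x \<in> I \<Longrightarrow> \<psi> x (B x) \<noteq> 0"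
    and \<psi>_other: "\<And>x y. x \<in> I \<Longrightarrow> y \<in> I \<Longrightarrow> x \<noteq> y \<Longrightarrow> \<psi> x (B y) = 0"
begin

lemma dual_inj: "inj_on B I"
  by (rule inj_onI) (metis \<psi>_same \<psi>_other)

lemma dual_sum:
  assumes "finite T" "T \<subseteq> B ` I" "x \<in> I" "B x \<in> T"
  shows "\<psi> x (\<Sum>v\<in>T. qscale (u v) v) = u (B x) * \<psi> x (B x)"
proof -
  have zero: "\<psi> x 0 = 0" using \<psi>_scale[of x 0 0] by simp
  have "\<psi> x (\<Sum>v\<in>T. qscale (u v) v) = (\<Sum>v\<in>T. u v * \<psi> x v)"
    by (induction T rule: infinite_finite_induct) (simp_all add: zero \<psi>_add \<psi>_scale)
  also have "\<dots> = (\<Sum>v\<in>T. if v = B x then u v * \<psi> x v else 0)"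
    using assms \<psi>_other by (intro sum.cong) auto
  finally show ?thesis using assms by simp
qed

lemma dual_independent: "qmat.independent (B ` I)"
proof
  assume "qmat.dependent (B ` I)"
  then obtain T u v where T: "finite T" "T \<subseteq> B ` I" "(\<Sum>v\<in>T. qscale (u v) v) = 0" "v \<in> T" "u v \<noteq> 0"
    unfolding qmat.dependent_explicit by blast
  then obtain x where x: "x \<in> I" "v = B x" by blast
  have "\<psi> x 0 = 0" using \<psi>_scale[of x 0 0] by simp
  then show False using dual_sum[OF T(1,2) x(1), of u] T x \<psi>_same by simp
qed

lemma dual_separates:
  assumes "f \<in> qmat.span (B ` I)" "\<And>x. x \<in> I \<Longrightarrow> \<psi> x f = 0"
  shows "f = 0"
proof -
  obtain T u where T: "finite T" "T \<subseteq> B ` I" "f = (\<Sum>v\<in>T. qscale (u v) v)"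
    using assms(1) unfolding qmat.span_explicit by blast
  have "u v = 0" if v: "v \<in> T" for v
  proof -
    obtain x where x: "x \<in> I" "v = B x" using v T by blast
    then show ?thesis using dual_sum[OF T(1,2) x(1), of u] v T(3) assms(2) \<psi>_same by simp
  qed
  then show ?thesis by (simp add: T(3))
qed

end

section \<open>The dual functionals and the splitting of the kernel\<close>

context quantum_calculus
begin

text \<open>\<open>k\<close> Laplacians strip off \<open>detq ^ k\<close>, after which a coefficient
  modulo \<open>detq\<close> detects the \<open>Xcoeff\<close>. The natural subtraction is exact on
  \<open>Xcoeff_index\<close>.\<close>

fun Xcoeff_dual :: "nat \<times> nat \<times> nat \<times> nat \<Rightarrow> qmat \<Rightarrow> cq" where
  "Xcoeff_dual (i, j, t, k) f = segre_coeff t (i + j - t) i j ((laplacian p ^^ k) f)"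

lemma laplacian_zero: "laplacian p 0 = 0"
  using laplacian_scale[of 0 0] by simp

lemma laplacian_funpow_add: "(laplacian p ^^ k) (f + g) = (laplacian p ^^ k) f + (laplacian p ^^ k) g"
  by (induction k) (simp_all add: laplacian_add)

lemma laplacian_funpow_scale: "(laplacian p ^^ k) (qscale c f) = qscale c ((laplacian p ^^ k) f)"
  by (induction k) (simp_all add: laplacian_scale)

lemma laplacian_funpow_zero: "(laplacian p ^^ k) 0 = 0"
  by (induction k) (simp_all add: laplacian_zero)

lemma laplacian_funpow_Xcoeff_detq:
  "\<exists>c. c \<noteq> 0 \<and> (laplacian p ^^ k) (Xcoeff i j t * detq ^ (k + m)) = qscale c (Xcoeff i j t * detq ^ m)"
proof (induction k)
  case 0
  show ?case by (rule exI[of _ 1]) simp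
next
  case (Suc k)
  then obtain c where c: "c \<noteq> 0"
    "(laplacian p ^^ k) (Xcoeff i j t * detq ^ (k + m)) = qscale c (Xcoeff i j t * detq ^ m)" by blast
  let ?d = "laplace_num (i + j) (Suc (k + m))"
  have "(laplacian p ^^ Suc k) (Xcoeff i j t * detq ^ (Suc k + m)) = qscale (?d * c) (Xcoeff i j t * detq ^ m)"
    by (simp only: funpow_Suc_right o_def add_Suc laplacian_Xcoeff_detq nat.case laplacian_funpow_scale c
        qmat.scale_scale)
  moreover have "?d * c \<noteq> 0" using c positive_nonzero[OF positive_laplace_num] by simp
  ultimately show ?case by blast
qed

lemma laplacian_funpow_Xcoeff_detq_less: "m < k \<Longrightarrow> (laplacian p ^^ k) (Xcoeff i j t * detq ^ m) = 0"
proof -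
  assume "m < k"
  then obtain n where k: "k = n + Suc m" by (metis add.commute less_iff_Suc_add add_Suc_right)
  obtain c where "(laplacian p ^^ m) (Xcoeff i j t * detq ^ (m + 0)) = qscale c (Xcoeff i j t * detq ^ 0)"
    using laplacian_funpow_Xcoeff_detq by blast
  then have "(laplacian p ^^ Suc m) (Xcoeff i j t * detq ^ m) = 0"
    by (simp add: laplacian_scale laplacian_Xcoeff)
  then show ?thesis by (simp only: k funpow_add o_def laplacian_funpow_zero)
qed

lemma Xcoeff_dual_add: "Xcoeff_dual x (f + g) = Xcoeff_dual x f + Xcoeff_dual x g"
  by (cases x) (simp add: laplacian_funpow_add segre_coeff_add)

lemma Xcoeff_dual_scale: "Xcoeff_dual x (qscale c f) = c * Xcoeff_dual x f"
  by (cases x) (simp add: laplacian_funpow_scale segre_coeff_scale)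

lemma Xcoeff_dual_same:
  assumes "x \<in> Xcoeff_index"
  shows "Xcoeff_dual x (Xcoeff_det x) \<noteq> 0"
proof -
  obtain i j t k where x: "x = (i, j, t, k)" by (cases x)
  obtain c where c: "c \<noteq> 0" "(laplacian p ^^ k) (Xcoeff i j t * detq ^ (k + 0)) = qscale c (Xcoeff i j t * detq ^ 0)"
    using laplacian_funpow_Xcoeff_detq by blast
  then have "Xcoeff_dual x (Xcoeff_det x) = c * segre_coeff t (i + j - t) i j (Xcoeff i j t)"
    by (simp add: x Xcoeff_det_def segre_coeff_scale)
  then show ?thesis
    using assms c positive_nonzero[OF positive_qbinom] by (simp add: x Xcoeff_index_def segre_coeff_Xcoeff)
qed

lemma Xcoeff_dual_other:
  assumes "x \<in> Xcoeff_index" "y \<in> Xcoeff_index" "x \<noteq> y"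
  shows "Xcoeff_dual x (Xcoeff_det y) = 0"
proof -
  obtain i j t k where x: "x = (i, j, t, k)" by (cases x)
  obtain i' j' t' m where y: "y = (i', j', t', m)" by (cases y)
  \<comment> \<open>For m < k the Laplacians annihilate the vector; for m = k the coefficients
    separate; for m > k a factor \<open>detq\<close> remains and the coefficient vanishes.\<close>
  consider "m < k" | "m = k" | n where "m = k + Suc n" 
    by (metis less_iff_Suc_add add_Suc_right linorder_neqE_nat)
  then show ?thesis
  proof cases
    case 1
    then show ?thesis by (simp add: x y Xcoeff_det_def laplacian_funpow_Xcoeff_detq_less segre_coeff_zero)
  next
    case 2
    obtain c where "(laplacian p ^^ k) (Xcoeff i' j' t' * detq ^ (k + 0)) = qscale c (Xcoeff i' j' t' * detq ^ 0)"
      using laplacian_funpow_Xcoeff_detq by blast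
    then have "Xcoeff_dual x (Xcoeff_det y) = c * segre_coeff t (i + j - t) i j (Xcoeff i' j' t')"
      by (simp add: x y 2 Xcoeff_det_def segre_coeff_scale)
    then show ?thesis using assms 2 by (auto simp: x y segre_coeff_Xcoeff)
  next
    case 3
    obtain c where "(laplacian p ^^ k) (Xcoeff i' j' t' * detq ^ m) = qscale c (Xcoeff i' j' t' * detq ^ Suc n)"
      using laplacian_funpow_Xcoeff_detq 3 by blast
    then show ?thesis
      by (simp add: x y Xcoeff_det_def segre_coeff_scale power_Suc2 segre_coeff_mult_detq flip: mult.assoc del: power_Suc)
  qed
qed

lemma Xcoeff_det_0: "Xcoeff_det (i, j, t, 0) = Xcoeff i j t"
  by (simp add: Xcoeff_det_def)

lemma laplacian_kernel:
  "qmat.span (Xcoeff_det ` {x \<in> Xcoeff_index. snd (snd (snd x)) = 0}) = {f. laplacian p f = 0}"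
    (is "qmat.span (Xcoeff_det ` ?H) = _")
proof (intro subset_antisym subsetI)
  have H: "laplacian p h = 0" if "h \<in> qmat.span (Xcoeff_det ` ?H)" for h
    using that
  proof (induction h rule: qmat.span_induct_alt)
    case (step c x y)
    then obtain i j t where "x = Xcoeff i j t" by (auto simp: Xcoeff_det_0)
    then show ?case using step by (simp add: laplacian_add laplacian_scale laplacian_Xcoeff)
  qed (rule laplacian_zero)
  fix f
  show "f \<in> {f. laplacian p f = 0}" if "f \<in> qmat.span (Xcoeff_det ` ?H)"
    using H[OF that] by simp
  assume "f \<in> {f. laplacian p f = 0}"
  then have f: "laplacian p f = 0" by simp
  let ?K = "{x \<in> Xcoeff_index. snd (snd (snd x)) \<noteq> 0}"
  have "Xcoeff_index = ?H \<union> ?K" by auto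
  then have "f \<in> qmat.span (Xcoeff_det ` ?H \<union> Xcoeff_det ` ?K)"
    using span_Xcoeff_det by (metis UNIV_I image_Un)
  then obtain h g where fhg: "f = h + g" and h: "h \<in> qmat.span (Xcoeff_det ` ?H)"
    and g: "g \<in> qmat.span (Xcoeff_det ` ?K)"
    unfolding qmat.span_Un by blast
  then have "laplacian p g = 0" using f H[OF h] by (simp add: laplacian_add)
  then have "Xcoeff_dual x g = 0" if "x \<in> ?K" for x
    using that by (cases x; cases "snd (snd (snd x))")
      (auto simp: funpow_Suc_right laplacian_funpow_zero segre_coeff_zero simp del: funpow.simps)
  \<comment> \<open>The functionals with \<open>k > 0\<close> factor through the Laplacian.\<close>
  then have "g = 0"
    by (intro dual_separates[where \<psi> = Xcoeff_dual and I = ?K, OF Xcoeff_dual_add Xcoeff_dual_scale _ _ g])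
       (auto simp: Xcoeff_dual_same Xcoeff_dual_other simp del: Xcoeff_dual.simps)
  then show "f \<in> qmat.span (Xcoeff_det ` ?H)" using h fhg by simp
qed

end

section \<open>Translation to the half-integer indices\<close>

fun Xtuple :: "rat \<times> rat \<times> rat \<Rightarrow> nat \<times> nat \<times> nat \<times> nat" where
  "Xtuple (l, m, n) = (nat \<lfloor>l - m\<rfloor>, nat \<lfloor>l + m\<rfloor>, nat \<lfloor>l - n\<rfloor>, 0)"

text \<open>The differences l - m and l - n are integers between 0 and 2l; they become
  \<open>i\<close> and \<open>t\<close>, and j = 2l - i.\<close>

lemma Xindex_obtain:
  assumes "(l, m, n) \<in> Xindex"
  obtains i j t :: nat where "l = (of_nat i + of_nat j) / 2" "m = (of_nat j - of_nat i) / 2"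
    "n = (of_nat i + of_nat j) / 2 - of_nat t" "t \<le> i + j"
proof -
  obtain k :: nat where k: "l = of_nat k / 2" "- l \<le> n" "n \<le> l" "- l \<le> m" "m \<le> l"
    "n - l \<in> \<int>" "m - l \<in> \<int>"
    using assms by (auto simp: Xindex_def)
  from k(6) obtain a where a: "n - l = of_int a" by (rule Ints_cases)
  from k(7) obtain b where b: "m - l = of_int b" by (rule Ints_cases)
  note ab = a b
  have "(of_int (- a) :: rat) \<ge> 0" "(of_int (- a) :: rat) \<le> of_int (int k)"
     "(of_int (- b) :: rat) \<ge> 0" "(of_int (- b) :: rat) \<le> of_int (int k)"
    using k ab by auto
  then have int: "- a \<ge> 0" "- a \<le> int k" "- b \<ge> 0" "- b \<le> int k"
    unfolding of_int_le_iff of_int_0_le_iff by auto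
  then obtain t i where ti: "- a = int t" "- b = int i" by (metis nonneg_int_cases)
  then have "i \<le> k" "t \<le> k" using int by auto
  then obtain j where "k = i + j" using le_Suc_ex by blast
  moreover have "n - l = - of_nat t" "m - l = - of_nat i"
    using ab ti by (metis add.inverse_inverse of_int_minus of_int_of_nat_eq)+
  ultimately show ?thesis
    using k(1) \<open>t \<le> k\<close> by (intro that[of i j t]) (auto simp: field_simps)
qed

lemma Xtuple_eq:
  "Xtuple ((of_nat i + of_nat j) / 2, (of_nat j - of_nat i) / 2, (of_nat i + of_nat j) / 2 - of_nat t)
    = (i, j, t, 0)"
proof -
  have "(of_nat i + of_nat j) / 2 - (of_nat j - of_nat i) / 2 = (of_nat i :: rat)"
    "(of_nat i + of_nat j) / 2 + (of_nat j - of_nat i) / 2 = (of_nat j :: rat)"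
    by (simp_all add: field_simps)
  then show ?thesis by simp
qed

lemma inj_on_Xtuple: "inj_on Xtuple Xindex"
proof (rule inj_onI)
  fix x y assume "x \<in> Xindex" "y \<in> Xindex" "Xtuple x = Xtuple y"
  then show "x = y"
    by (cases x; cases y) (metis Pair_inject Xindex_obtain Xtuple_eq)
qed

lemma image_Xtuple: "Xtuple ` Xindex = {x \<in> Xcoeff_index. snd (snd (snd x)) = 0}"
proof (intro subset_antisym subsetI)
  fix y assume "y \<in> Xtuple ` Xindex"
  then obtain l m n where "(l, m, n) \<in> Xindex" "y = Xtuple (l, m, n)" by auto
  then show "y \<in> {x \<in> Xcoeff_index. snd (snd (snd x)) = 0}"
    by (metis (mono_tags, lifting) Xcoeff_index_def Xindex_obtain Xtuple_eq mem_Collect_eq case_prod_conv snd_conv)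
next
  fix y assume "y \<in> {x \<in> Xcoeff_index. snd (snd (snd x)) = 0}"
  then obtain i j t where y: "y = (i, j, t, 0)" "t \<le> i + j" by (auto simp: Xcoeff_index_def)
  \<comment> \<open>The solution of l - m = i, l + m = j, l - n = t.\<close>
  let ?x = "((of_nat i + of_nat j) / 2, (of_nat j - of_nat i) / 2, (of_nat i + of_nat j) / 2 - of_nat t) :: rat \<times> rat \<times> rat"
  have 1: "(of_nat j - of_nat i) / 2 - (of_nat i + of_nat j) / 2 = (- of_nat i :: rat)"
    by (simp add: field_simps)
  have "of_nat t \<le> (of_nat (i + j) :: rat)" using y(2) by (simp only: of_nat_le_iff)
  then have "?x \<in> Xindex"
    unfolding Xindex_def using 1 by (auto intro!: exI[of _ "i + j"] simp: field_simps)
  then show "y \<in> Xtuple ` Xindex" using Xtuple_eq y(1) by (metis image_eqI)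
qed

lemma Xelem_eq: "(l, m, n) \<in> Xindex \<Longrightarrow> Xelem l m n = Xcoeff_det (Xtuple (l, m, n))"
proof -
  assume lmn: "(l, m, n) \<in> Xindex"
  then obtain i j t :: nat where eq: "l = (of_nat i + of_nat j) / 2" "m = (of_nat j - of_nat i) / 2"
    "n = (of_nat i + of_nat j) / 2 - of_nat t" by (rule Xindex_obtain)
  have "Xtuple (l, m, n) = (i, j, t, 0)" unfolding eq by (rule Xtuple_eq)
  then have ij: "nat \<lfloor>l - m\<rfloor> = i" "nat \<lfloor>l + m\<rfloor> = j" by simp_all
  \<comment> \<open>The factor s^(-t-1) makes the residue extract the coefficient of s^t.\<close>
  have "n - l - 1 = of_int (- int t - 1)" unfolding eq by simp
  then have "\<lfloor>n - l - 1\<rfloor> = - int t - 1" by (simp only: floor_of_int)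
  then have "Xelem l m n = Xcoeff i j t"
    unfolding Xelem_def ij Xcoeff_def col_fls_def[symmetric] by (simp add: fls_shifted_times_simps)
  then show ?thesis using \<open>Xtuple (l, m, n) = _\<close> by (simp add: Xcoeff_det_def)
qed

theorem proposition28:
  fixes p :: cq
  assumes "p = qpar \<or> p = inverse qpar"
  shows "inj_on (\<lambda>(l, m, n). Xelem l m n) Xindex \<and>
    qmat.independent ((\<lambda>(l, m, n). Xelem l m n) ` Xindex) \<and>
    qmat.span ((\<lambda>(l, m, n). Xelem l m n) ` Xindex) = {f. laplacian p f = 0}"
proof -
  interpret quantum_calculus p by (rule quantum_calculus.intro) fact
  note dual = Xcoeff_dual_add Xcoeff_dual_scale Xcoeff_dual_same Xcoeff_dual_other
  let ?H = "{x \<in> Xcoeff_index. snd (snd (snd x)) = 0}"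
  have X: "(\<lambda>(l, m, n). Xelem l m n) x = (Xcoeff_det \<circ> Xtuple) x" if "x \<in> Xindex" for x
    using that by (cases x) (simp add: Xelem_eq del: Xtuple.simps)
  \<comment> \<open>Injectivity and independence are obtained for all powers of \<open>detq\<close>
    and then restricted to the power 0.\<close>
  have "inj_on Xcoeff_det Xcoeff_index" by (rule dual_inj[where \<psi> = Xcoeff_dual]) (rule dual; assumption)+
  then have "inj_on Xcoeff_det ?H" by (rule inj_on_subset) auto
  then have "inj_on (Xcoeff_det \<circ> Xtuple) Xindex"
    by (intro comp_inj_on inj_on_Xtuple) (simp only: image_Xtuple)
  moreover have "qmat.independent (Xcoeff_det ` Xcoeff_index)"
    by (rule dual_independent[where \<psi> = Xcoeff_dual]) (rule dual; assumption)+
  then have "qmat.independent (Xcoeff_det ` ?H)" by (rule qmat.independent_mono) auto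
  moreover have "(\<lambda>(l, m, n). Xelem l m n) ` Xindex = Xcoeff_det ` ?H"
    using X unfolding image_Xtuple[symmetric] by (simp add: image_image cong: image_cong)
  ultimately show ?thesis
    using laplacian_kernel inj_on_cong[of Xindex "\<lambda>(l, m, n). Xelem l m n" "Xcoeff_det \<circ> Xtuple", OF X]
    by (simp only: simp_thms)
qed

end
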